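(* Let $C$ and $D$ be abelian categories and $I$ a small category. Let $F=(\{F_n\}_{n\in\mathbb{Z}},\{\delta_n\})$ be a homological $\delta$-functor $C\to D$. Then the exponent functors $F_n^I\colon C^I\to D^I$, together with the maps $\delta_n^I\colon F_n^I(N)\to F_{n-1}^I(L)$ (one for each short exact sequence $0\to L\to M\to N\to 0$ in $C^I$ and each $n$) whose $i$th component is the map $\delta_n\colon F_n(N^i)\to F_{n-1}(L^i)$ associated by $F$ to the short exact sequence $0\to L^i\to M^i\to N^i\to 0$ in $C$, form a homological $\delta$-functor from $C^I$ to $D^I$, denoted $F^I$. Moreover, given homological $\delta$-functors $F,G\colon C\to D$ and a morphism of homological $\delta$-functors $\eta=\{\eta_n\}\colon F\to G$, we get a morphism of homological $\delta$-functors $\eta^I=\{\eta_n^I\}\colon F^I\to G^I$, where for $A\in C^I$ the morphism $\eta^I_{n,A}\colon F_n^I(A)\to G_n^I(A)$ has $i$th component $\eta_{n,A^i}\colon F_n(A^i)\to G_n(A^i)$.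
   Context: $C^I$ denotes the category of functors $I\to C$ with natural transformations as morphisms; it is abelian when $C$ is. For $A\in C^I$, $A^i$ denotes its value at $i\in I$ (the $i$th component), and for a morphism $f$ in $C^I$, $f^i$ denotes its component at $i$. A sequence in $C^I$ is exact iff it is exact at each component. For a functor $F\colon C\to D$, the exponent $F^I\colon C^I\to D^I$ is post-composition with $F$: on objects $F^I(A)^i=F(A^i)$, with $F$ applied to the structure maps of $A$, and on morphisms $F^I(f)^i=F(f^i)$. A homological $\delta$-functor $F\colon C\to D$ is a collection of additive functors $F_n\colon C\to D$, $n\in\mathbb{Z}$, together with, for each short exact sequence $0\to L\to M\to N\to 0$ in $C$ and each $n$, a morphism $\delta_n\colon F_n(N)\to F_{n-1}(L)$, such that: (i) $F_n=0$ for $n<0$; (ii) for each such short exact sequence the sequence $\cdots\to F_{n+1}(N)\xrightarrow{\delta_{n+1}}F_n(L)\to F_n(M)\to F_n(N)\xrightarrow{\delta_n}F_{n-1}(L)\to\cdots$ is exact; (iii) for each morphism of short exact sequences from $0\to L\to M\to N\to 0$ to $0\to L'\to M'\to N'\to 0$, with outer maps $f\colon L\to L'$ and $g\colon N\to N'$, one has $F_{n-1}(f)\circ\delta_n=\delta_n\circ F_n(g)$ for all $n$. A morphism of homological $\delta$-functors $F\to G$ is a collection of natural transformations $F_n\to G_n$ commuting with the maps $\delta_n$. *)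

theory Defs
  imports "HOL-Algebra.Group"
begin

section \<open>Categories, functors and natural transformations\<close>

record ('o, 'm) cat =
  Ob :: "'o set"
  Ar :: "'m set"
  Dom :: "'m \<Rightarrow> 'o"
  Cod :: "'m \<Rightarrow> 'o"
  Ident :: "'o \<Rightarrow> 'm"
  Comp :: "'m \<Rightarrow> 'm \<Rightarrow> 'm"  (infixr "\<cdot>\<index>" 70)

definition Hom :: "('o, 'm, 'z) cat_scheme \<Rightarrow> 'o \<Rightarrow> 'o \<Rightarrow> 'm set" where
  "Hom C A B = {f \<in> Ar C. Dom C f = A \<and> Cod C f = B}"

locale category =
  fixes C :: "('o, 'm, 'z) cat_scheme"  (structure)
  assumes Dom_in: "f \<in> Ar C \<Longrightarrow> Dom C f \<in> Ob C"
    and Cod_in: "f \<in> Ar C \<Longrightarrow> Cod C f \<in> Ob C"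
    and Ident_in: "A \<in> Ob C \<Longrightarrow> Ident C A \<in> Hom C A A"
    and Comp_in: "f \<in> Hom C X Y \<Longrightarrow> g \<in> Hom C Y Z \<Longrightarrow> g \<cdot> f \<in> Hom C X Z"
    and Comp_Ident: "f \<in> Hom C X Y \<Longrightarrow> f \<cdot> Ident C X = f"
    and Ident_Comp: "f \<in> Hom C X Y \<Longrightarrow> Ident C Y \<cdot> f = f"
    and Comp_assoc: "f \<in> Hom C W X \<Longrightarrow> g \<in> Hom C X Y \<Longrightarrow> h \<in> Hom C Y Z \<Longrightarrow>
      (h \<cdot> g) \<cdot> f = h \<cdot> (g \<cdot> f)"

record ('o, 'm, 'p, 'n) functr =
  omap :: "'o \<Rightarrow> 'p"
  amap :: "'m \<Rightarrow> 'n"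

definition is_functor ::
  "('o, 'm, 'y) cat_scheme \<Rightarrow> ('p, 'n, 'z) cat_scheme \<Rightarrow> ('o, 'm, 'p, 'n) functr \<Rightarrow> bool" where
  "is_functor C D F \<longleftrightarrow>
    (\<forall>A\<in>Ob C. omap F A \<in> Ob D) \<and>
    (\<forall>f\<in>Ar C. amap F f \<in> Hom D (omap F (Dom C f)) (omap F (Cod C f))) \<and>
    (\<forall>A\<in>Ob C. amap F (Ident C A) = Ident D (omap F A)) \<and>
    (\<forall>f\<in>Ar C. \<forall>g\<in>Ar C. Cod C f = Dom C g \<longrightarrow>
      amap F (g \<cdot>\<^bsub>C\<^esub> f) = amap F g \<cdot>\<^bsub>D\<^esub> amap F f)"

definition is_nat_trans ::
  "('o, 'm, 'y) cat_scheme \<Rightarrow> ('p, 'n, 'z) cat_scheme \<Rightarrow>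
   ('o, 'm, 'p, 'n) functr \<Rightarrow> ('o, 'm, 'p, 'n) functr \<Rightarrow> ('o \<Rightarrow> 'n) \<Rightarrow> bool" where
  "is_nat_trans C D F G \<tau> \<longleftrightarrow>
    (\<forall>A\<in>Ob C. \<tau> A \<in> Hom D (omap F A) (omap G A)) \<and>
    (\<forall>f\<in>Ar C. \<tau> (Cod C f) \<cdot>\<^bsub>D\<^esub> amap F f = amap G f \<cdot>\<^bsub>D\<^esub> \<tau> (Dom C f))"


section \<open>Abelian categories\<close>

text \<open>\<open>Add\<close> is only meaningful on parallel arrows, and \<open>Zero C A B\<close> is the zero morphism
  from \<open>A\<close> to \<open>B\<close>.\<close>

record ('o, 'm) addcat = "('o, 'm) cat" +
  Add :: "'m \<Rightarrow> 'm \<Rightarrow> 'm"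
  Zero :: "'o \<Rightarrow> 'o \<Rightarrow> 'm"

definition hom_group :: "('o, 'm) addcat \<Rightarrow> 'o \<Rightarrow> 'o \<Rightarrow> 'm monoid" where
  "hom_group C A B = \<lparr>carrier = Hom C A B, mult = Add C, one = Zero C A B\<rparr>"

locale preadditive_category = category C
  for C :: "('o, 'm) addcat"  (structure) +
  assumes hom_comm_group: "A \<in> Ob C \<Longrightarrow> B \<in> Ob C \<Longrightarrow> comm_group (hom_group C A B)"
    and Comp_Add_left: "f \<in> Hom C X Y \<Longrightarrow> g \<in> Hom C Y Z \<Longrightarrow> g' \<in> Hom C Y Z \<Longrightarrow>
      Add C g g' \<cdot> f = Add C (g \<cdot> f) (g' \<cdot> f)"
    and Comp_Add_right: "f \<in> Hom C X Y \<Longrightarrow> f' \<in> Hom C X Y \<Longrightarrow> g \<in> Hom C Y Z \<Longrightarrow>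
      g \<cdot> Add C f f' = Add C (g \<cdot> f) (g \<cdot> f')"

definition zero_object :: "('o, 'm) addcat \<Rightarrow> 'o \<Rightarrow> bool" where
  "zero_object C Z \<longleftrightarrow> Z \<in> Ob C \<and>
    (\<forall>A\<in>Ob C. (\<exists>!f. f \<in> Hom C Z A) \<and> (\<exists>!f. f \<in> Hom C A Z))"

definition is_biproduct ::
  "('o, 'm) addcat \<Rightarrow> 'o \<Rightarrow> 'o \<Rightarrow> 'o \<Rightarrow> 'm \<Rightarrow> 'm \<Rightarrow> 'm \<Rightarrow> 'm \<Rightarrow> bool" where
  "is_biproduct C A B P p q i j \<longleftrightarrow>
    P \<in> Ob C \<and> p \<in> Hom C P A \<and> q \<in> Hom C P B \<and> i \<in> Hom C A P \<and> j \<in> Hom C B P \<and>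
    p \<cdot>\<^bsub>C\<^esub> i = Ident C A \<and> q \<cdot>\<^bsub>C\<^esub> j = Ident C B \<and>
    Add C (i \<cdot>\<^bsub>C\<^esub> p) (j \<cdot>\<^bsub>C\<^esub> q) = Ident C P"

definition is_kernel :: "('o, 'm) addcat \<Rightarrow> 'm \<Rightarrow> 'm \<Rightarrow> bool" where
  "is_kernel C k f \<longleftrightarrow> k \<in> Ar C \<and> f \<in> Ar C \<and> Cod C k = Dom C f \<and>
    f \<cdot>\<^bsub>C\<^esub> k = Zero C (Dom C k) (Cod C f) \<and>
    (\<forall>h\<in>Ar C. Cod C h = Dom C f \<longrightarrow> f \<cdot>\<^bsub>C\<^esub> h = Zero C (Dom C h) (Cod C f) \<longrightarrow>
      (\<exists>!u. u \<in> Hom C (Dom C h) (Dom C k) \<and> k \<cdot>\<^bsub>C\<^esub> u = h))"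

definition is_cokernel :: "('o, 'm) addcat \<Rightarrow> 'm \<Rightarrow> 'm \<Rightarrow> bool" where
  "is_cokernel C c f \<longleftrightarrow> c \<in> Ar C \<and> f \<in> Ar C \<and> Cod C f = Dom C c \<and>
    c \<cdot>\<^bsub>C\<^esub> f = Zero C (Dom C f) (Cod C c) \<and>
    (\<forall>h\<in>Ar C. Dom C h = Cod C f \<longrightarrow> h \<cdot>\<^bsub>C\<^esub> f = Zero C (Dom C f) (Cod C h) \<longrightarrow>
      (\<exists>!u. u \<in> Hom C (Cod C c) (Cod C h) \<and> u \<cdot>\<^bsub>C\<^esub> c = h))"

definition is_mono :: "('o, 'm) addcat \<Rightarrow> 'm \<Rightarrow> bool" where
  "is_mono C m \<longleftrightarrow> m \<in> Ar C \<and>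
    (\<forall>X. \<forall>f\<in>Hom C X (Dom C m). \<forall>g\<in>Hom C X (Dom C m). m \<cdot>\<^bsub>C\<^esub> f = m \<cdot>\<^bsub>C\<^esub> g \<longrightarrow> f = g)"

definition is_epi :: "('o, 'm) addcat \<Rightarrow> 'm \<Rightarrow> bool" where
  "is_epi C e \<longleftrightarrow> e \<in> Ar C \<and>
    (\<forall>X. \<forall>f\<in>Hom C (Cod C e) X. \<forall>g\<in>Hom C (Cod C e) X. f \<cdot>\<^bsub>C\<^esub> e = g \<cdot>\<^bsub>C\<^esub> e \<longrightarrow> f = g)"

locale abelian_category = preadditive_category +
  assumes ex_zero_object: "\<exists>Z. zero_object C Z"
    and ex_biproduct: "A \<in> Ob C \<Longrightarrow> B \<in> Ob C \<Longrightarrow> \<exists>P p q i j. is_biproduct C A B P p q i j"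
    and ex_kernel: "f \<in> Ar C \<Longrightarrow> \<exists>k. is_kernel C k f"
    and ex_cokernel: "f \<in> Ar C \<Longrightarrow> \<exists>c. is_cokernel C c f"
    and mono_is_kernel: "is_mono C m \<Longrightarrow> \<exists>f. is_kernel C m f"
    and epi_is_cokernel: "is_epi C e \<Longrightarrow> \<exists>f. is_cokernel C e f"

definition is_image :: "('o, 'm) addcat \<Rightarrow> 'm \<Rightarrow> 'm \<Rightarrow> bool" where
  "is_image C k f \<longleftrightarrow> (\<exists>c. is_cokernel C c f \<and> is_kernel C k c)"

text \<open>Exactness of \<open>X \<rightarrow> Y \<rightarrow> Z\<close> at \<open>Y\<close>: the image of \<open>f\<close> and the kernel of \<open>g\<close> are the same
  subobject of \<open>Y\<close>, that is, they have a common representative.\<close>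

definition exact :: "('o, 'm) addcat \<Rightarrow> 'm \<Rightarrow> 'm \<Rightarrow> bool" where
  "exact C f g \<longleftrightarrow> f \<in> Ar C \<and> g \<in> Ar C \<and> Cod C f = Dom C g \<and>
    (\<exists>k. is_image C k f \<and> is_kernel C k g)"

definition short_exact :: "('o, 'm) addcat \<Rightarrow> 'm \<Rightarrow> 'm \<Rightarrow> bool" where
  "short_exact C f g \<longleftrightarrow> (\<exists>Z. zero_object C Z \<and>
    exact C (Zero C Z (Dom C f)) f \<and> exact C f g \<and> exact C g (Zero C (Cod C g) Z))"

definition additive_functor ::
  "('o, 'm) addcat \<Rightarrow> ('p, 'n) addcat \<Rightarrow> ('o, 'm, 'p, 'n) functr \<Rightarrow> bool" where
  "additive_functor C D F \<longleftrightarrow> is_functor C D F \<and>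
    (\<forall>f\<in>Ar C. \<forall>g\<in>Ar C. Dom C f = Dom C g \<and> Cod C f = Cod C g \<longrightarrow>
      amap F (Add C f g) = Add D (amap F f) (amap F g))"


section \<open>Homological delta-functors\<close>

text \<open>A short exact sequence \<open>0 \<rightarrow> L \<rightarrow> M \<rightarrow> N \<rightarrow> 0\<close> is given by its two arrows \<open>f : L \<rightarrow> M\<close> and
  \<open>g : M \<rightarrow> N\<close>; accordingly \<open>dlt F n f g\<close> is the connecting map \<open>F\<^sub>n N \<rightarrow> F\<^sub>n\<^sub>-\<^sub>1 L\<close>.\<close>

record ('o, 'm, 'p, 'n) delta_data =
  fn :: "int \<Rightarrow> ('o, 'm, 'p, 'n) functr"
  dlt :: "int \<Rightarrow> 'm \<Rightarrow> 'm \<Rightarrow> 'n"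

locale homological_delta_functor =
  C: abelian_category C + D: abelian_category D
  for C :: "('o, 'm) addcat" and D :: "('p, 'n) addcat" +
  fixes F :: "('o, 'm, 'p, 'n) delta_data"
  assumes additive: "additive_functor C D (fn F n)"
    and dlt_in: "short_exact C f g \<Longrightarrow>
      dlt F n f g \<in> Hom D (omap (fn F n) (Cod C g)) (omap (fn F (n - 1)) (Dom C f))"
    and vanish: "n < 0 \<Longrightarrow> A \<in> Ob C \<Longrightarrow> zero_object D (omap (fn F n) A)"
    and exact_left: "short_exact C f g \<Longrightarrow> exact D (dlt F (n + 1) f g) (amap (fn F n) f)"
    and exact_mid: "short_exact C f g \<Longrightarrow> exact D (amap (fn F n) f) (amap (fn F n) g)"
    and exact_right: "short_exact C f g \<Longrightarrow> exact D (amap (fn F n) g) (dlt F n f g)"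
    and dlt_natural: "short_exact C f g \<Longrightarrow> short_exact C f' g' \<Longrightarrow>
      a \<in> Hom C (Dom C f) (Dom C f') \<Longrightarrow> b \<in> Hom C (Cod C f) (Cod C f') \<Longrightarrow>
      c \<in> Hom C (Cod C g) (Cod C g') \<Longrightarrow>
      b \<cdot>\<^bsub>C\<^esub> f = f' \<cdot>\<^bsub>C\<^esub> a \<Longrightarrow> c \<cdot>\<^bsub>C\<^esub> g = g' \<cdot>\<^bsub>C\<^esub> b \<Longrightarrow>
      amap (fn F (n - 1)) a \<cdot>\<^bsub>D\<^esub> dlt F n f g = dlt F n f' g' \<cdot>\<^bsub>D\<^esub> amap (fn F n) c"

locale delta_functor_morphism =
  F: homological_delta_functor C D F + G: homological_delta_functor C D G
  for C :: "('o, 'm) addcat" and D :: "('p, 'n) addcat"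
    and F G :: "('o, 'm, 'p, 'n) delta_data" +
  fixes \<eta> :: "int \<Rightarrow> 'o \<Rightarrow> 'n"
  assumes nat_trans: "is_nat_trans C D (fn F n) (fn G n) (\<eta> n)"
    and dlt_commute: "short_exact C f g \<Longrightarrow>
      \<eta> (n - 1) (Dom C f) \<cdot>\<^bsub>D\<^esub> dlt F n f g = dlt G n f g \<cdot>\<^bsub>D\<^esub> \<eta> n (Cod C g)"


section \<open>Functor categories and exponents\<close>

text \<open>Maps on objects and arrows of \<open>I\<close> are made extensional, so that equality in \<open>C\<^sup>I\<close> is
  equality of functors and of natural transformations.\<close>

record ('i, 'j, 'o, 'm) ntr =
  src :: "('i, 'j, 'o, 'm) functr"
  tgt :: "('i, 'j, 'o, 'm) functr"
  cmp :: "'i \<Rightarrow> 'm"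

definition functor_category ::
  "('i, 'j) cat \<Rightarrow> ('o, 'm) addcat \<Rightarrow> (('i, 'j, 'o, 'm) functr, ('i, 'j, 'o, 'm) ntr) addcat" where
  "functor_category I C =
    (let obs = {A. is_functor I C A \<and> omap A \<in> extensional (Ob I) \<and> amap A \<in> extensional (Ar I)}
     in \<lparr>Ob = obs,
      Ar = {\<phi>. src \<phi> \<in> obs \<and> tgt \<phi> \<in> obs \<and> cmp \<phi> \<in> extensional (Ob I) \<and>
        is_nat_trans I C (src \<phi>) (tgt \<phi>) (cmp \<phi>)},
      Dom = src,
      Cod = tgt,
      Ident = (\<lambda>A. \<lparr>src = A, tgt = A, cmp = (\<lambda>i\<in>Ob I. Ident C (omap A i))\<rparr>),
      Comp = (\<lambda>\<psi> \<phi>. \<lparr>src = src \<phi>, tgt = tgt \<psi>, cmp = (\<lambda>i\<in>Ob I. cmp \<psi> i \<cdot>\<^bsub>C\<^esub> cmp \<phi> i)\<rparr>),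
      Add = (\<lambda>\<phi> \<psi>. \<lparr>src = src \<phi>, tgt = tgt \<phi>, cmp = (\<lambda>i\<in>Ob I. Add C (cmp \<phi> i) (cmp \<psi> i))\<rparr>),
      Zero = (\<lambda>A B. \<lparr>src = A, tgt = B, cmp = (\<lambda>i\<in>Ob I. Zero C (omap A i) (omap B i))\<rparr>)\<rparr>)"

definition exp_obj ::
  "('i, 'j) cat \<Rightarrow> ('o, 'm, 'p, 'n) functr \<Rightarrow> ('i, 'j, 'o, 'm) functr \<Rightarrow> ('i, 'j, 'p, 'n) functr" where
  "exp_obj I F A =
    \<lparr>omap = (\<lambda>i\<in>Ob I. omap F (omap A i)), amap = (\<lambda>u\<in>Ar I. amap F (amap A u))\<rparr>"

definition exp_functor ::
  "('i, 'j) cat \<Rightarrow> ('o, 'm, 'p, 'n) functr \<Rightarrow>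
   (('i, 'j, 'o, 'm) functr, ('i, 'j, 'o, 'm) ntr, ('i, 'j, 'p, 'n) functr, ('i, 'j, 'p, 'n) ntr) functr" where
  "exp_functor I F =
    \<lparr>omap = exp_obj I F,
     amap = (\<lambda>\<phi>. \<lparr>src = exp_obj I F (src \<phi>), tgt = exp_obj I F (tgt \<phi>),
       cmp = (\<lambda>i\<in>Ob I. amap F (cmp \<phi> i))\<rparr>)\<rparr>"

definition exp_delta ::
  "('i, 'j) cat \<Rightarrow> ('o, 'm, 'p, 'n) delta_data \<Rightarrow>
   (('i, 'j, 'o, 'm) functr, ('i, 'j, 'o, 'm) ntr, ('i, 'j, 'p, 'n) functr, ('i, 'j, 'p, 'n) ntr) delta_data" where
  "exp_delta I F =
    \<lparr>fn = (\<lambda>n. exp_functor I (fn F n)),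
     dlt = (\<lambda>n f g. \<lparr>src = exp_obj I (fn F n) (tgt g), tgt = exp_obj I (fn F (n - 1)) (src f),
       cmp = (\<lambda>i\<in>Ob I. dlt F n (cmp f i) (cmp g i))\<rparr>)\<rparr>"

definition exp_morphism ::
  "('i, 'j) cat \<Rightarrow> ('o, 'm, 'p, 'n) delta_data \<Rightarrow> ('o, 'm, 'p, 'n) delta_data \<Rightarrow>
   (int \<Rightarrow> 'o \<Rightarrow> 'n) \<Rightarrow> int \<Rightarrow> ('i, 'j, 'o, 'm) functr \<Rightarrow> ('i, 'j, 'p, 'n) ntr" where
  "exp_morphism I F G \<eta> n A =
    \<lparr>src = exp_obj I (fn F n) A, tgt = exp_obj I (fn G n) A, cmp = (\<lambda>i\<in>Ob I. \<eta> n (omap A i))\<rparr>"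

end

theory Submission imports Defs begin

text \<open>Kernels and biproducts in \<open>C\<^sup>I\<close> can be chosen componentwise, the universal property supplying
  the structure maps, and by uniqueness up to isomorphism every kernel is then a componentwise one.
  Cokernels follow by duality, since \<open>(C\<^sup>I)\<^sup>o\<^sup>p\<close> is the category of functors from \<open>I\<^sup>o\<^sup>p\<close> to \<open>C\<^sup>o\<^sup>p\<close>.
  Hence \<open>C\<^sup>I\<close> is abelian and exactness is tested componentwise, so all axioms of a
  \<open>\<delta>\<close>-functor are inherited componentwise. The one point that is not formal is that the components of
  the connecting map form a natural transformation: an arrow \<open>i \<rightarrow> j\<close> of \<open>I\<close> induces a morphism
  between the short exact sequences at \<open>i\<close> and \<open>j\<close>, to which the naturality of \<open>\<delta>\<close> applies.\<close>

section \<open>Preadditive categories\<close>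

text \<open>Kernels, images and exactness are defined by existence, so a statement that holds at
  every \<open>i\<close> yields representatives that vary with \<open>i\<close> and need not fit
  together. The remedy is to choose once in \<open>C\<^sup>I\<close> and compare at each component:
  a cokernel \<open>c\<close> and a kernel \<open>k\<close> of it are taken in the functor category,
  after it is shown in a single preadditive category that any such choice works. The same obstacle
  meets a monomorphism \<open>m\<close>: each \<open>cmp m i\<close> is the kernel of some arrow,
  but these arrows need not be natural in \<open>i\<close>, and the components of one cokernel of
  \<open>m\<close> replace them. That the components of \<open>m\<close> are monic is not visible
  from the definition, whose test objects are functors; it is read off from the kernel of
  \<open>m\<close>, which is zero and componentwise. Duality is an isomorphism and not an identity,
  because arrows of \<open>C\<^sup>I\<close> store their source and target. Whatever is chosen
  pointwise is natural by uniqueness: two candidates agree after a kernel inclusion, after both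
  projections, or after adding the same arrow.\<close>

lemma HomI: "f \<in> Ar C \<Longrightarrow> f \<in> Hom C (Dom C f) (Cod C f)"
  by (simp add: Hom_def)

lemma HomD:
  assumes "f \<in> Hom C A B"
  shows "f \<in> Ar C" "Dom C f = A" "Cod C f = B"
  using assms by (auto simp: Hom_def)

lemma (in category) Hom_Ob:
  assumes "f \<in> Hom C A B"
  shows "A \<in> Ob C" "B \<in> Ob C"
  using assms Dom_in Cod_in by (auto simp: Hom_def)

context preadditive_category
begin

lemma Zero_in: "A \<in> Ob C \<Longrightarrow> B \<in> Ob C \<Longrightarrow> Zero C A B \<in> Hom C A B"
  using monoid.one_closed[OF group.is_monoid[OF comm_group.axioms(2)[OF hom_comm_group]], of A B]
  by (simp add: hom_group_def)

lemma Add_in: "f \<in> Hom C A B \<Longrightarrow> g \<in> Hom C A B \<Longrightarrow> Add C f g \<in> Hom C A B"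
  using monoid.m_closed[OF group.is_monoid[OF comm_group.axioms(2)[OF hom_comm_group]], of A B f g] Hom_Ob
  by (simp add: hom_group_def)

lemma Add_Zero_left: "f \<in> Hom C A B \<Longrightarrow> Add C (Zero C A B) f = f"
  using monoid.l_one[OF group.is_monoid[OF comm_group.axioms(2)[OF hom_comm_group]], of A B f] Hom_Ob
  by (simp add: hom_group_def)

lemma Add_Zero_right: "f \<in> Hom C A B \<Longrightarrow> Add C f (Zero C A B) = f"
  using monoid.r_one[OF group.is_monoid[OF comm_group.axioms(2)[OF hom_comm_group]], of A B f] Hom_Ob
  by (simp add: hom_group_def)

lemma Add_assoc:
  "f \<in> Hom C A B \<Longrightarrow> g \<in> Hom C A B \<Longrightarrow> h \<in> Hom C A B \<Longrightarrow>
    Add C (Add C f g) h = Add C f (Add C g h)"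
  using monoid.m_assoc[OF group.is_monoid[OF comm_group.axioms(2)[OF hom_comm_group]], of A B f g h] Hom_Ob
  by (simp add: hom_group_def)

lemma Add_commute: "f \<in> Hom C A B \<Longrightarrow> g \<in> Hom C A B \<Longrightarrow> Add C f g = Add C g f"
  using comm_monoid.m_comm[OF comm_group.axioms(1)[OF hom_comm_group], of A B f g] Hom_Ob
  by (simp add: hom_group_def)

lemma ex_negative:
  assumes "f \<in> Hom C A B"
  obtains g where "g \<in> Hom C A B" "Add C g f = Zero C A B"
  using group.l_inv_ex[OF comm_group.axioms(2)[OF hom_comm_group], of A B f] assms Hom_Ob
  by (auto simp: hom_group_def)

lemma Add_right_cancel:
  assumes "f \<in> Hom C A B" "g \<in> Hom C A B" "h \<in> Hom C A B"
  shows "Add C f h = Add C g h \<longleftrightarrow> f = g"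
  using group.right_cancel[OF comm_group.axioms(2)[OF hom_comm_group], of A B h f g] assms Hom_Ob
  by (auto simp: hom_group_def)

lemma Add_self_eq_Zero: "f \<in> Hom C A B \<Longrightarrow> Add C f f = f \<Longrightarrow> f = Zero C A B"
  by (metis Add_Zero_left Add_right_cancel Zero_in Hom_Ob)

text \<open>Bilinearity makes the composite equal to its own double, and in a group only the unit
  has this property.\<close>

lemma Comp_Zero:
  assumes "g \<in> Hom C Y Z" "X \<in> Ob C"
  shows "g \<cdot> Zero C X Y = Zero C X Z"
proof -
  have z: "Zero C X Y \<in> Hom C X Y" using assms Zero_in Hom_Ob by blast
  have "Add C (g \<cdot> Zero C X Y) (g \<cdot> Zero C X Y) = g \<cdot> Zero C X Y"
    using Comp_Add_right[OF z z assms(1)] Add_Zero_left[OF z] by simp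
  then show ?thesis using Add_self_eq_Zero Comp_in[OF z assms(1)] by blast
qed

lemma Zero_Comp:
  assumes "f \<in> Hom C X Y" "Z \<in> Ob C"
  shows "Zero C Y Z \<cdot> f = Zero C X Z"
proof -
  have z: "Zero C Y Z \<in> Hom C Y Z" using assms Zero_in Hom_Ob by blast
  have "Add C (Zero C Y Z \<cdot> f) (Zero C Y Z \<cdot> f) = Zero C Y Z \<cdot> f"
    using Comp_Add_left[OF assms(1) z z] Add_Zero_left[OF z] by simp
  then show ?thesis using Add_self_eq_Zero Comp_in[OF assms(1) z] by blast
qed

text \<open>An arrow out of \<open>Z\<close> is its own composite with \<open>Ident C Z\<close>,
  hence zero once the identity is; similarly for arrows into \<open>Z\<close>. The condition is
  thereby a single equation between arrows, which can be tested componentwise in a functor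
  category.\<close>

lemma zero_object_iff: "zero_object C Z \<longleftrightarrow> Z \<in> Ob C \<and> Ident C Z = Zero C Z Z"
proof (intro iffI conjI)
  assume "zero_object C Z"
  then show "Z \<in> Ob C" "Ident C Z = Zero C Z Z"
    using Ident_in Zero_in unfolding zero_object_def by blast+
next
  assume Z: "Z \<in> Ob C \<and> Ident C Z = Zero C Z Z"
  have "f = Zero C Z A" if "f \<in> Hom C Z A" for f A
    using Comp_Ident[OF that] Comp_Zero[OF that] Z by simp
  moreover have "f = Zero C A Z" if "f \<in> Hom C A Z" for f A
    using Ident_Comp[OF that] Zero_Comp[OF that] Z by simp
  ultimately show "zero_object C Z"
    using Z Zero_in unfolding zero_object_def by blast
qed


section \<open>Kernels\<close>

lemma is_kernel_Hom:
  assumes "is_kernel C k f"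
  shows "k \<in> Hom C (Dom C k) (Dom C f)" "f \<in> Hom C (Dom C f) (Cod C f)"
    "f \<cdot> k = Zero C (Dom C k) (Cod C f)"
  using assms by (auto simp: is_kernel_def Hom_def)

lemma is_kernel_ex1:
  assumes "is_kernel C k f" "h \<in> Hom C X (Dom C f)" "f \<cdot> h = Zero C X (Cod C f)"
  shows "\<exists>!u. u \<in> Hom C X (Dom C k) \<and> k \<cdot> u = h"
proof -
  have "\<forall>h\<in>Ar C. Cod C h = Dom C f \<longrightarrow> f \<cdot> h = Zero C (Dom C h) (Cod C f) \<longrightarrow>
      (\<exists>!u. u \<in> Hom C (Dom C h) (Dom C k) \<and> k \<cdot> u = h)"
    using assms(1) unfolding is_kernel_def by (elim conjE)
  from bspec[OF this HomD(1)[OF assms(2)]] show ?thesis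
    using HomD(2,3)[OF assms(2)] assms(3) by simp
qed

lemma is_kernel_factor:
  assumes "is_kernel C k f" "h \<in> Hom C X (Dom C f)" "f \<cdot> h = Zero C X (Cod C f)"
  obtains u where "u \<in> Hom C X (Dom C k)" "k \<cdot> u = h"
  using is_kernel_ex1[OF assms] by blast

text \<open>Kernels are monic: \<open>u\<close> and \<open>v\<close> both factor the one arrow
  \<open>k \<cdot> u\<close>, which \<open>f\<close> kills.\<close>

lemma is_kernel_cancel:
  assumes k: "is_kernel C k f" and u: "u \<in> Hom C X (Dom C k)" and v: "v \<in> Hom C X (Dom C k)"
    and eq: "k \<cdot> u = k \<cdot> v"
  shows "u = v"
proof -
  note kf = is_kernel_Hom[OF k]
  have "f \<cdot> (k \<cdot> u) = Zero C X (Cod C f)"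
    using Comp_assoc[OF u kf(1,2)] kf(3) Zero_Comp[OF u] Hom_Ob[OF kf(2)] by simp
  from is_kernel_ex1[OF k Comp_in[OF u kf(1)] this] show ?thesis
    by (rule ex1E) (metis u v eq)
qed

text \<open>The unique existence in \<open>is_kernel\<close> is split into factorization and
  cancellation, with variables for sources and targets, which is the form in which the constructions
  below deliver it.\<close>

lemma is_kernelI:
  assumes k: "k \<in> Hom C K X" and f: "f \<in> Hom C X Y" and z: "f \<cdot> k = Zero C K Y"
    and factor: "\<And>W h. h \<in> Hom C W X \<Longrightarrow> f \<cdot> h = Zero C W Y \<Longrightarrow> \<exists>u\<in>Hom C W K. k \<cdot> u = h"
    and cancel: "\<And>W u v. u \<in> Hom C W K \<Longrightarrow> v \<in> Hom C W K \<Longrightarrow> k \<cdot> u = k \<cdot> v \<Longrightarrow> u = v"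
  shows "is_kernel C k f"
proof -
  have "\<exists>!u. u \<in> Hom C (Dom C h) K \<and> k \<cdot> u = h"
    if h: "h \<in> Ar C" "Cod C h = X" "f \<cdot> h = Zero C (Dom C h) Y" for h
  proof -
    have "h \<in> Hom C (Dom C h) X" using h by (simp add: Hom_def)
    from factor[OF this h(3)] obtain u where "u \<in> Hom C (Dom C h) K" "k \<cdot> u = h" by blast
    then show ?thesis using cancel by (metis (full_types))
  qed
  then show ?thesis
    unfolding is_kernel_def HomD(2,3)[OF k] HomD(2,3)[OF f] using HomD(1)[OF k] HomD(1)[OF f] z by simp
qed

text \<open>Each kernel factors through the other, and the composites of the two factors are
  identities because they are so after the monic \<open>k\<close> or \<open>k'\<close>.\<close>

lemma is_kernel_unique:
  assumes "is_kernel C k f" "is_kernel C k' f"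
  obtains u v where "u \<in> Hom C (Dom C k') (Dom C k)" "v \<in> Hom C (Dom C k) (Dom C k')"
    "k \<cdot> u = k'" "k' \<cdot> v = k" "u \<cdot> v = Ident C (Dom C k)" "v \<cdot> u = Ident C (Dom C k')"
proof -
  note K = is_kernel_Hom[OF assms(1)] and K' = is_kernel_Hom[OF assms(2)]
  obtain u where u: "u \<in> Hom C (Dom C k') (Dom C k)" "k \<cdot> u = k'"
    using is_kernel_factor[OF assms(1) K'(1,3)] .
  obtain v where v: "v \<in> Hom C (Dom C k) (Dom C k')" "k' \<cdot> v = k"
    using is_kernel_factor[OF assms(2) K(1,3)] .
  have "k \<cdot> (u \<cdot> v) = k \<cdot> Ident C (Dom C k)"
    using Comp_assoc[OF v(1) u(1) K(1)] u v Comp_Ident[OF K(1)] by simp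
  then have uv: "u \<cdot> v = Ident C (Dom C k)"
    by (rule is_kernel_cancel[OF assms(1) Comp_in[OF v(1) u(1)] Ident_in[OF Hom_Ob(1)[OF K(1)]]])
  have "k' \<cdot> (v \<cdot> u) = k' \<cdot> Ident C (Dom C k')"
    using Comp_assoc[OF u(1) v(1) K'(1)] u v Comp_Ident[OF K'(1)] by simp
  then have "v \<cdot> u = Ident C (Dom C k')"
    by (rule is_kernel_cancel[OF assms(2) Comp_in[OF u(1) v(1)] Ident_in[OF Hom_Ob(1)[OF K'(1)]]])
  then show thesis using that[OF u(1) v(1) u(2) v(2) uv] by simp
qed

text \<open>A factorization \<open>w\<close> through \<open>k\<close> turns into
  \<open>v \<cdot> w\<close> through \<open>k \<cdot> u\<close>; and \<open>k \<cdot> u\<close> can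
  be cancelled since \<open>k\<close> can and \<open>v\<close> undoes \<open>u\<close>.\<close>

lemma is_kernel_iso:
  assumes k: "is_kernel C k f" and u: "u \<in> Hom C K (Dom C k)" and v: "v \<in> Hom C (Dom C k) K"
    and uv: "u \<cdot> v = Ident C (Dom C k)" and vu: "v \<cdot> u = Ident C K"
  shows "is_kernel C (k \<cdot> u) f"
proof (rule is_kernelI)
  note kf = is_kernel_Hom[OF k]
  show ku: "k \<cdot> u \<in> Hom C K (Dom C f)" using Comp_in[OF u kf(1)] .
  show "f \<in> Hom C (Dom C f) (Cod C f)" using kf(2) .
  show "f \<cdot> (k \<cdot> u) = Zero C K (Cod C f)"
    using Comp_assoc[OF u kf(1,2)] kf(3) Zero_Comp[OF u] Hom_Ob[OF kf(2)] by simp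
  fix W h assume "h \<in> Hom C W (Dom C f)" "f \<cdot> h = Zero C W (Cod C f)"
  then obtain w where w: "w \<in> Hom C W (Dom C k)" "k \<cdot> w = h"
    using is_kernel_factor[OF k] by metis
  have "(k \<cdot> u) \<cdot> (v \<cdot> w) = k \<cdot> ((u \<cdot> v) \<cdot> w)"
    using Comp_assoc[OF Comp_in[OF w(1) v] u kf(1)] Comp_assoc[OF w(1) v u] by simp
  then have "(k \<cdot> u) \<cdot> (v \<cdot> w) = h" using uv Ident_Comp[OF w(1)] w(2) by simp
  then show "\<exists>u'\<in>Hom C W K. (k \<cdot> u) \<cdot> u' = h" using Comp_in[OF w(1) v] by blast
next
  note kf = is_kernel_Hom[OF k]
  fix W x y assume xy: "x \<in> Hom C W K" "y \<in> Hom C W K" "(k \<cdot> u) \<cdot> x = (k \<cdot> u) \<cdot> y"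
  then have "u \<cdot> x = u \<cdot> y"
    using is_kernel_cancel[OF k Comp_in[OF _ u] Comp_in[OF _ u]] Comp_assoc[OF _ u kf(1)] by metis
  then have "(v \<cdot> u) \<cdot> x = (v \<cdot> u) \<cdot> y"
    using Comp_assoc[OF _ u v] xy by metis
  then show "x = y" using vu Ident_Comp xy by metis
qed

text \<open>Being a kernel of \<open>g\<close> depends only on the subobject, and two kernels of
  \<open>f\<close> represent the same one.\<close>

lemma is_kernel_transfer:
  assumes "is_kernel C k f" "is_kernel C k' f" "is_kernel C k g"
  shows "is_kernel C k' g"
proof -
  obtain u v where "u \<in> Hom C (Dom C k') (Dom C k)" "v \<in> Hom C (Dom C k) (Dom C k')"
    "k \<cdot> u = k'" "u \<cdot> v = Ident C (Dom C k)" "v \<cdot> u = Ident C (Dom C k')"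
    using is_kernel_unique[OF assms(1,2)] by metis
  then show ?thesis using is_kernel_iso[OF assms(3)] by metis
qed

text \<open>Together with \<open>kernel_Zero_is_mono\<close> this turns monicity into a condition on
  a kernel, which passes to the components of a functor category, whereas the test objects in
  \<open>is_mono\<close> do not.\<close>

lemma is_mono_kernel_Zero:
  assumes "is_mono C m" "is_kernel C k m"
  shows "k = Zero C (Dom C k) (Dom C m)"
proof -
  note km = is_kernel_Hom[OF assms(2)]
  have "m \<cdot> k = m \<cdot> Zero C (Dom C k) (Dom C m)"
    using km(3) Comp_Zero[OF km(2)] Hom_Ob[OF km(1)] by simp
  then show ?thesis
    using assms(1) km(1) Zero_in[OF Hom_Ob[OF km(1)]] unfolding is_mono_def by blast
qed

text \<open>The difference of two arrows with equal composites is killed by \<open>m\<close>, so it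
  factors through the zero arrow \<open>k\<close>.\<close>

lemma kernel_Zero_is_mono:
  assumes k: "is_kernel C k m" "k = Zero C (Dom C k) (Dom C m)"
  shows "is_mono C m"
  unfolding is_mono_def
proof (intro conjI ballI allI impI)
  note km = is_kernel_Hom[OF k(1)]
  show "m \<in> Ar C" using HomD(1)[OF km(2)] .
  fix X f g assume f: "f \<in> Hom C X (Dom C m)" and g: "g \<in> Hom C X (Dom C m)"
    and eq: "m \<cdot> f = m \<cdot> g"
  \<comment> \<open>\<open>g'\<close> is the negative of \<open>g\<close>, so
    \<open>Add C g' f\<close> is the difference that has to vanish.\<close>
  obtain g' where g': "g' \<in> Hom C X (Dom C m)" "Add C g' g = Zero C X (Dom C m)"
    using ex_negative[OF g] .
  have "m \<cdot> Add C g' f = m \<cdot> Add C g' g"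
    using Comp_Add_right[OF g'(1) _ km(2)] f g eq by simp
  also have "\<dots> = Zero C X (Cod C m)"
    using g'(2) Comp_Zero[OF km(2)] Hom_Ob[OF f] by simp
  finally obtain w where w: "w \<in> Hom C X (Dom C k)" "k \<cdot> w = Add C g' f"
    using is_kernel_factor[OF k(1) Add_in[OF g'(1) f]] by blast
  have "Add C g' f = Zero C X (Dom C m)"
    using w k(2) Zero_Comp[OF w(1)] Hom_Ob[OF km(1)] by metis
  then show "f = g"
    using g' Add_right_cancel[OF f g g'(1)] Add_commute f g by metis
qed

end


section \<open>Duality\<close>

definition op_cat :: "('o, 'm, 'z) cat_scheme \<Rightarrow> ('o, 'm, 'z) cat_scheme" where
  "op_cat C = C\<lparr>Dom := Cod C, Cod := Dom C, Comp := (\<lambda>g f. f \<cdot>\<^bsub>C\<^esub> g)\<rparr>"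

text \<open>Zero arrows are indexed by source and target, so these two arguments are exchanged as
  well; \<open>Add\<close> is kept because parallel arrows stay parallel. The index category, which
  has no zero arrows, is dualized by \<open>op_cat\<close> alone.\<close>

definition op_addcat :: "('o, 'm) addcat \<Rightarrow> ('o, 'm) addcat" where
  "op_addcat C = (op_cat C)\<lparr>Zero := (\<lambda>A B. Zero C B A)\<rparr>"

lemma op_cat_simps [simp]:
  "Ob (op_cat C) = Ob C" "Ar (op_cat C) = Ar C" "Dom (op_cat C) = Cod C" "Cod (op_cat C) = Dom C"
  "Ident (op_cat C) = Ident C" "g \<cdot>\<^bsub>op_cat C\<^esub> f = f \<cdot>\<^bsub>C\<^esub> g" "Hom (op_cat C) A B = Hom C B A"
  by (auto simp: op_cat_def Hom_def)

lemma op_addcat_simps [simp]: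
  "Ob (op_addcat C) = Ob C" "Ar (op_addcat C) = Ar C" "Dom (op_addcat C) = Cod C"
  "Cod (op_addcat C) = Dom C" "Ident (op_addcat C) = Ident C" "g \<cdot>\<^bsub>op_addcat C\<^esub> f = f \<cdot>\<^bsub>C\<^esub> g"
  "Add (op_addcat C) = Add C" "Zero (op_addcat C) A B = Zero C B A" "Hom (op_addcat C) A B = Hom C B A"
  by (auto simp: op_addcat_def op_cat_def Hom_def)

lemma hom_group_op [simp]: "hom_group (op_addcat C) A B = hom_group C B A"
  by (simp add: hom_group_def)

lemma is_kernel_op: "is_kernel (op_addcat C) k f \<longleftrightarrow> is_cokernel C k f"
  unfolding is_kernel_def is_cokernel_def op_addcat_simps eq_commute[of "Cod C f" "Dom C k"] ..

lemma is_cokernel_op: "is_cokernel (op_addcat C) k f \<longleftrightarrow> is_kernel C k f"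
  unfolding is_kernel_def is_cokernel_def op_addcat_simps eq_commute[of "Cod C k" "Dom C f"] ..

lemma is_mono_op: "is_mono (op_addcat C) m \<longleftrightarrow> is_epi C m"
  unfolding is_mono_def is_epi_def by simp

lemma is_epi_op: "is_epi (op_addcat C) m \<longleftrightarrow> is_mono C m"
  unfolding is_mono_def is_epi_def by simp

lemma zero_object_op: "zero_object (op_addcat C) Z \<longleftrightarrow> zero_object C Z"
  unfolding zero_object_def op_addcat_simps by (simp only: conj_commute)

lemma is_biproduct_op: "is_biproduct (op_addcat C) A B P p q i j \<longleftrightarrow> is_biproduct C A B P i j p q"
  unfolding is_biproduct_def by auto

lemma (in category) category_op_cat: "category (op_cat C)"
  by (rule category.intro; (unfold op_cat_simps)?)
    (auto intro: Dom_in Cod_in Ident_in Comp_in Comp_Ident Ident_Comp Comp_assoc[symmetric])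

lemma (in preadditive_category) category_op_addcat: "category (op_addcat C)"
  by (rule category.intro; (unfold op_addcat_simps)?)
    (auto intro: Dom_in Cod_in Ident_in Comp_in Comp_Ident Ident_Comp Comp_assoc[symmetric])

lemma (in preadditive_category) preadditive_category_op: "preadditive_category (op_addcat C)"
  by (rule preadditive_category.intro[OF category_op_addcat],
      unfold preadditive_category_axioms_def op_addcat_simps hom_group_op)
    (auto intro: hom_comm_group Comp_Add_left Comp_Add_right)

text \<open>Every axiom is self-dual or comes with its dual: kernels with cokernels, monos with
  epis, and in a biproduct the projections with the injections.\<close>

lemma (in abelian_category) abelian_category_op: "abelian_category (op_addcat C)"
proof (rule abelian_category.intro[OF preadditive_category_op], unfold abelian_category_axioms_def, intro conjI allI impI)
  show "\<exists>Z. zero_object (op_addcat C) Z" using ex_zero_object by (simp only: zero_object_op)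
next
  fix A B assume "A \<in> Ob (op_addcat C)" "B \<in> Ob (op_addcat C)"
  then have "\<exists>P p q i j. is_biproduct C A B P p q i j" using ex_biproduct by simp
  then show "\<exists>P p q i j. is_biproduct (op_addcat C) A B P p q i j"
    unfolding is_biproduct_op by blast
qed (simp_all only: op_addcat_simps is_kernel_op is_cokernel_op is_mono_op is_epi_op ex_kernel ex_cokernel
      mono_is_kernel epi_is_cokernel)

section \<open>Cokernels by duality\<close>

context preadditive_category
begin

lemmas is_cokernel_Hom = preadditive_category.is_kernel_Hom
  [OF preadditive_category_op, unfolded is_kernel_op op_addcat_simps]

lemmas is_cokernel_factor = preadditive_category.is_kernel_factor
  [OF preadditive_category_op, unfolded is_kernel_op op_addcat_simps]

text \<open>Since \<open>f\<close> kills \<open>m\<close>, it factors as \<open>w \<cdot> c\<close>;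
  so whatever \<open>c\<close> kills is killed by \<open>f\<close> and factors through
  \<open>m\<close>. The unspecified arrow \<open>f\<close> can thus be traded for any chosen
  cokernel of \<open>m\<close>.\<close>

lemma kernel_of_cokernel:
  assumes m: "is_kernel C m f" and c: "is_cokernel C c m"
  shows "is_kernel C m c"
proof (rule is_kernelI)
  note mf = is_kernel_Hom[OF m] and cm = is_cokernel_Hom[OF c]
  have m_Hom: "m \<in> Hom C (Dom C m) (Cod C m)" using HomI[OF HomD(1)[OF mf(1)]] .
  have Cod_m: "Cod C m = Dom C f" using HomD(3)[OF mf(1)] .
  have f_Hom: "f \<in> Hom C (Cod C m) (Cod C f)" unfolding Cod_m using mf(2) .
  show "m \<in> Hom C (Dom C m) (Cod C m)" using m_Hom .
  show "c \<in> Hom C (Cod C m) (Cod C c)" "c \<cdot> m = Zero C (Dom C m) (Cod C c)" using cm(1,3) .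
  obtain w where w: "w \<in> Hom C (Cod C c) (Cod C f)" "w \<cdot> c = f"
    using is_cokernel_factor[OF c f_Hom mf(3)] .
  fix W h assume h: "h \<in> Hom C W (Cod C m)" "c \<cdot> h = Zero C W (Cod C c)"
  have "f \<cdot> h = Zero C W (Cod C f)"
    using Comp_assoc[OF h(1) cm(1) w(1)] w h(2) Comp_Zero[OF w(1)] Hom_Ob[OF h(1)] by simp
  then obtain u where "u \<in> Hom C W (Dom C m)" "m \<cdot> u = h"
    using is_kernel_factor[OF m h(1)[unfolded Cod_m]] by auto
  then show "\<exists>u\<in>Hom C W (Dom C m). m \<cdot> u = h" by auto
qed (rule is_kernel_cancel[OF m])

end

section \<open>Biproducts, and exactness tested on any chosen cokernel and kernel\<close>

context preadditive_category
begin

lemma is_biproduct_in: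
  assumes "is_biproduct C A B P p q i j"
  shows "P \<in> Ob C" "p \<in> Hom C P A" "q \<in> Hom C P B" "i \<in> Hom C A P" "j \<in> Hom C B P"
    "p \<cdot> i = Ident C A" "q \<cdot> j = Ident C B" "Add C (i \<cdot> p) (j \<cdot> q) = Ident C P"
  using assms by (simp_all add: is_biproduct_def)

lemma is_biproduct_swap:
  assumes "is_biproduct C A B P p q i j"
  shows "is_biproduct C B A P q p j i"
proof -
  note b = is_biproduct_in[OF assms]
  show ?thesis
    using b Add_commute[OF Comp_in[OF b(2,4)] Comp_in[OF b(3,5)]] by (simp add: is_biproduct_def)
qed

text \<open>The mixed relations are not listed in the definition but follow from it. Composing
  \<open>p\<close> with the decomposition of the identity writes \<open>p\<close> as the sum of
  \<open>p\<close> and \<open>(p \<cdot> j) \<cdot> q\<close>, so the latter vanishes, and composing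
  it with \<open>j\<close> leaves \<open>p \<cdot> j\<close>.\<close>

lemma is_biproduct_proj_inj:
  assumes "is_biproduct C A B P p q i j"
  shows "p \<cdot> j = Zero C B A"
proof -
  note b = is_biproduct_in[OF assms]
  note pj = Comp_in[OF b(5,2)] and ip = Comp_in[OF b(2,4)] and jq = Comp_in[OF b(3,5)]
  note pjq = Comp_in[OF b(3) pj]
  have "p = p \<cdot> Add C (i \<cdot> p) (j \<cdot> q)" using Comp_Ident[OF b(2)] b(8) by simp
  also have "\<dots> = Add C ((p \<cdot> i) \<cdot> p) ((p \<cdot> j) \<cdot> q)"
    using Comp_Add_right[OF ip jq b(2)] Comp_assoc[OF b(2,4,2)] Comp_assoc[OF b(3,5,2)] by simp
  also have "\<dots> = Add C ((p \<cdot> j) \<cdot> q) p" using Ident_Comp[OF b(2)] b(6) Add_commute[OF b(2) pjq] by simp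
  finally have "Add C ((p \<cdot> j) \<cdot> q) p = Add C (Zero C P A) p" using Add_Zero_left[OF b(2)] by simp
  then have "(p \<cdot> j) \<cdot> q = Zero C P A"
    using Add_right_cancel[OF pjq Zero_in[OF Hom_Ob[OF b(2)]] b(2)] by simp
  then have "(p \<cdot> j) \<cdot> (q \<cdot> j) = Zero C B A"
    using Comp_assoc[OF b(5,3) pj] Zero_Comp[OF b(5) Hom_Ob(2)[OF b(2)]] by simp
  then show ?thesis using Comp_Ident[OF pj] b(7) by simp
qed

lemma is_biproduct_expand:
  assumes "is_biproduct C A B P p q i j" and m: "m \<in> Hom C X P"
  shows "m = Add C (i \<cdot> (p \<cdot> m)) (j \<cdot> (q \<cdot> m))"
proof -
  note b = is_biproduct_in[OF assms(1)]
  show ?thesis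
    using Comp_Add_left[OF m Comp_in[OF b(2,4)] Comp_in[OF b(3,5)]] Ident_Comp[OF m] b(8)
      Comp_assoc[OF m b(2,4)] Comp_assoc[OF m b(3,5)] by simp
qed

text \<open>The pairing of \<open>x\<close> and \<open>y\<close> is
  \<open>Add C (i \<cdot> x) (j \<cdot> y)\<close>. A biproduct is thus a product, which supplies
  the structure maps between biproducts chosen pointwise.\<close>

lemma is_biproduct_ex1:
  assumes "is_biproduct C A B P p q i j" and x: "x \<in> Hom C X A" and y: "y \<in> Hom C X B"
  shows "\<exists>!m. m \<in> Hom C X P \<and> p \<cdot> m = x \<and> q \<cdot> m = y"
proof
  note b = is_biproduct_in[OF assms(1)]
  note ix = Comp_in[OF x b(4)] and jy = Comp_in[OF y b(5)] and X = Hom_Ob(1)[OF x]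
  have "p \<cdot> Add C (i \<cdot> x) (j \<cdot> y) = x"
    using Comp_Add_right[OF ix jy b(2)] Comp_assoc[OF x b(4,2)] Comp_assoc[OF y b(5,2)] b(6)
      Ident_Comp[OF x] is_biproduct_proj_inj[OF assms(1)] Zero_Comp[OF y Hom_Ob(2)[OF x]]
      Add_Zero_right[OF x] by simp
  moreover have "q \<cdot> Add C (i \<cdot> x) (j \<cdot> y) = y"
    using Comp_Add_right[OF ix jy b(3)] Comp_assoc[OF x b(4,3)] Comp_assoc[OF y b(5,3)] b(7)
      Ident_Comp[OF y] is_biproduct_proj_inj[OF is_biproduct_swap[OF assms(1)]]
      Zero_Comp[OF x Hom_Ob(2)[OF y]] Add_Zero_left[OF y] by simp
  ultimately show "Add C (i \<cdot> x) (j \<cdot> y) \<in> Hom C X P \<and>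
      p \<cdot> Add C (i \<cdot> x) (j \<cdot> y) = x \<and> q \<cdot> Add C (i \<cdot> x) (j \<cdot> y) = y"
    using Add_in[OF ix jy] by simp
  show "m = Add C (i \<cdot> x) (j \<cdot> y)" if "m \<in> Hom C X P \<and> p \<cdot> m = x \<and> q \<cdot> m = y" for m
    using is_biproduct_expand[OF assms(1), of m X] that by simp
qed

lemma is_biproduct_cancel:
  assumes "is_biproduct C A B P p q i j" and m: "m \<in> Hom C X P" and n: "n \<in> Hom C X P"
    and "p \<cdot> m = p \<cdot> n" "q \<cdot> m = q \<cdot> n"
  shows "m = n"
  using is_biproduct_expand[OF assms(1) m] is_biproduct_expand[OF assms(1) n] assms(4,5) by simp

text \<open>As \<open>c\<close> and \<open>c'\<close> factor through each other, they kill the same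
  arrows.\<close>

lemma is_kernel_of_factor:
  assumes k: "is_kernel C k c" and w: "w \<in> Hom C (Cod C c) Y" and v: "v \<in> Hom C Y (Cod C c)"
    and c': "w \<cdot> c = c'" and c: "v \<cdot> c' = c"
  shows "is_kernel C k c'"
proof (rule is_kernelI)
  note kc = is_kernel_Hom[OF k]
  show "k \<in> Hom C (Dom C k) (Dom C c)" using kc(1) .
  show c'_in: "c' \<in> Hom C (Dom C c) Y" using Comp_in[OF kc(2) w] c' by simp
  show "c' \<cdot> k = Zero C (Dom C k) Y"
    using Comp_assoc[OF kc(1,2) w] kc(3) c' Comp_Zero[OF w Hom_Ob(1)[OF kc(1)]] by simp
  fix W h assume h: "h \<in> Hom C W (Dom C c)" and z: "c' \<cdot> h = Zero C W Y"
  have "c \<cdot> h = Zero C W (Cod C c)"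
    using Comp_assoc[OF h c'_in v] z c Comp_Zero[OF v Hom_Ob(1)[OF h]] by simp
  then show "\<exists>u\<in>Hom C W (Dom C k). k \<cdot> u = h" using is_kernel_factor[OF k h] by metis
qed (rule is_kernel_cancel[OF k])

text \<open>\<open>exact\<close> grants only some cokernel of \<open>f\<close> and some kernel of it
  that is also a kernel of \<open>g\<close>. Two cokernels of \<open>f\<close> factor through each
  other, so \<open>k\<close> and the granted kernel are kernels of one arrow and hence the same
  subobject. Exactness can therefore be tested on representatives fixed in advance.\<close>

lemma exact_kernel_of_cokernel:
  assumes "exact C f g" and c: "is_cokernel C c f" and k: "is_kernel C k c"
  shows "is_kernel C k g"
proof -
  obtain k' c' where c': "is_cokernel C c' f" and k': "is_kernel C k' c'" "is_kernel C k' g"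
    using assms(1) unfolding exact_def is_image_def by metis
  note cf = is_cokernel_Hom[OF c] and cf' = is_cokernel_Hom[OF c']
  obtain w where "w \<in> Hom C (Cod C c) (Cod C c')" "w \<cdot> c = c'"
    using is_cokernel_factor[OF c cf'(1,3)] .
  moreover obtain v where "v \<in> Hom C (Cod C c') (Cod C c)" "v \<cdot> c' = c"
    using is_cokernel_factor[OF c' cf(1,3)] .
  ultimately have "is_kernel C k c'" using is_kernel_of_factor[OF k] by metis
  then show ?thesis by (rule is_kernel_transfer[OF k'(1) _ k'(2)])
qed

end

section \<open>Functor categories\<close>

lemma functor_category_simps:
  "Dom (functor_category I C) = src"
  "Cod (functor_category I C) = tgt"
  "Ident (functor_category I C) A = \<lparr>src = A, tgt = A, cmp = (\<lambda>i\<in>Ob I. Ident C (omap A i))\<rparr>"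
  "\<psi> \<cdot>\<^bsub>functor_category I C\<^esub> \<phi> =
    \<lparr>src = src \<phi>, tgt = tgt \<psi>, cmp = (\<lambda>i\<in>Ob I. cmp \<psi> i \<cdot>\<^bsub>C\<^esub> cmp \<phi> i)\<rparr>"
  "Add (functor_category I C) \<phi> \<psi> =
    \<lparr>src = src \<phi>, tgt = tgt \<phi>, cmp = (\<lambda>i\<in>Ob I. Add C (cmp \<phi> i) (cmp \<psi> i))\<rparr>"
  "Zero (functor_category I C) A B =
    \<lparr>src = A, tgt = B, cmp = (\<lambda>i\<in>Ob I. Zero C (omap A i) (omap B i))\<rparr>"
  by (simp_all add: functor_category_def Let_def)

lemma functor_category_Ob_iff:
  "A \<in> Ob (functor_category I C) \<longleftrightarrow>
    is_functor I C A \<and> omap A \<in> extensional (Ob I) \<and> amap A \<in> extensional (Ar I)"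
  by (simp add: functor_category_def Let_def)

lemma functor_category_Ar_iff:
  "\<phi> \<in> Ar (functor_category I C) \<longleftrightarrow>
    src \<phi> \<in> Ob (functor_category I C) \<and> tgt \<phi> \<in> Ob (functor_category I C) \<and>
    cmp \<phi> \<in> extensional (Ob I) \<and> is_nat_trans I C (src \<phi>) (tgt \<phi>) (cmp \<phi>)"
  by (simp add: functor_category_def Let_def)

lemma functor_category_Hom_iff:
  "\<phi> \<in> Hom (functor_category I C) A B \<longleftrightarrow>
    src \<phi> = A \<and> tgt \<phi> = B \<and> A \<in> Ob (functor_category I C) \<and> B \<in> Ob (functor_category I C) \<and>
    cmp \<phi> \<in> extensional (Ob I) \<and> is_nat_trans I C A B (cmp \<phi>)"
  by (auto simp: Hom_def functor_category_Ar_iff functor_category_simps)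

lemma omap_in: "A \<in> Ob (functor_category I C) \<Longrightarrow> i \<in> Ob I \<Longrightarrow> omap A i \<in> Ob C"
  by (simp add: functor_category_Ob_iff is_functor_def)

lemma amap_in:
  "A \<in> Ob (functor_category I C) \<Longrightarrow> u \<in> Hom I i j \<Longrightarrow> amap A u \<in> Hom C (omap A i) (omap A j)"
  using HomD[of u I i j] by (auto simp: functor_category_Ob_iff is_functor_def)

lemma amap_Ident:
  "A \<in> Ob (functor_category I C) \<Longrightarrow> i \<in> Ob I \<Longrightarrow> amap A (Ident I i) = Ident C (omap A i)"
  by (simp add: functor_category_Ob_iff is_functor_def)

lemma amap_Comp:
  "A \<in> Ob (functor_category I C) \<Longrightarrow> u \<in> Hom I i j \<Longrightarrow> v \<in> Hom I j k \<Longrightarrow>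
    amap A (v \<cdot>\<^bsub>I\<^esub> u) = amap A v \<cdot>\<^bsub>C\<^esub> amap A u"
  using HomD[of u I i j] HomD[of v I j k] by (simp add: functor_category_Ob_iff is_functor_def)

lemma cmp_in:
  "\<phi> \<in> Hom (functor_category I C) A B \<Longrightarrow> i \<in> Ob I \<Longrightarrow> cmp \<phi> i \<in> Hom C (omap A i) (omap B i)"
  by (simp add: functor_category_Hom_iff is_nat_trans_def)

lemma cmp_natural:
  "\<phi> \<in> Hom (functor_category I C) A B \<Longrightarrow> u \<in> Hom I i j \<Longrightarrow>
    cmp \<phi> j \<cdot>\<^bsub>C\<^esub> amap A u = amap B u \<cdot>\<^bsub>C\<^esub> cmp \<phi> i"
  using HomD[of u I i j] by (auto simp: functor_category_Hom_iff is_nat_trans_def)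

lemma ntr_eqI:
  assumes "\<phi> \<in> Hom (functor_category I C) A B" "\<psi> \<in> Hom (functor_category I C) A B"
    and "\<And>i. i \<in> Ob I \<Longrightarrow> cmp \<phi> i = cmp \<psi> i"
  shows "\<phi> = \<psi>"
proof -
  have "cmp \<phi> = cmp \<psi>"
    using assms by (intro extensionalityI[of _ "Ob I"]) (simp_all add: functor_category_Hom_iff)
  then show ?thesis using assms(1,2) by (simp add: functor_category_Hom_iff)
qed

lemma ntr_in_HomI:
  assumes "A \<in> Ob (functor_category I C)" "B \<in> Ob (functor_category I C)"
    and "\<And>i. i \<in> Ob I \<Longrightarrow> t i \<in> Hom C (omap A i) (omap B i)"
    and "\<And>u i j. u \<in> Hom I i j \<Longrightarrow> i \<in> Ob I \<Longrightarrow> j \<in> Ob I \<Longrightarrow>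
      t j \<cdot>\<^bsub>C\<^esub> amap A u = amap B u \<cdot>\<^bsub>C\<^esub> t i"
    and I: "category I"
  shows "\<lparr>src = A, tgt = B, cmp = restrict t (Ob I)\<rparr> \<in> Hom (functor_category I C) A B"
  using assms category.Hom_Ob[OF I HomI]
  by (auto simp: functor_category_Hom_iff is_nat_trans_def HomI)

lemma functr_in_ObI:
  assumes "\<And>i. i \<in> Ob I \<Longrightarrow> ob i \<in> Ob C"
    and "\<And>u i j. u \<in> Hom I i j \<Longrightarrow> i \<in> Ob I \<Longrightarrow> j \<in> Ob I \<Longrightarrow> ar u \<in> Hom C (ob i) (ob j)"
    and "\<And>i. i \<in> Ob I \<Longrightarrow> ar (Ident I i) = Ident C (ob i)"
    and "\<And>u v i j k. u \<in> Hom I i j \<Longrightarrow> v \<in> Hom I j k \<Longrightarrow> i \<in> Ob I \<Longrightarrow> j \<in> Ob I \<Longrightarrow> k \<in> Ob I \<Longrightarrow>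
      ar (v \<cdot>\<^bsub>I\<^esub> u) = ar v \<cdot>\<^bsub>C\<^esub> ar u"
    and I: "category I"
  shows "\<lparr>omap = restrict ob (Ob I), amap = restrict ar (Ar I)\<rparr> \<in> Ob (functor_category I C)"
proof -
  interpret I: category I by (rule I)
  have "Ident I i \<in> Ar I" if "i \<in> Ob I" for i using HomD(1)[OF I.Ident_in[OF that]] .
  moreover have "v \<cdot>\<^bsub>I\<^esub> u \<in> Ar I \<and> Dom I (v \<cdot>\<^bsub>I\<^esub> u) = Dom I u \<and> Cod I (v \<cdot>\<^bsub>I\<^esub> u) = Cod I v"
    if "u \<in> Ar I" "v \<in> Ar I" "Cod I u = Dom I v" for u v
    using that I.Comp_in[of u "Dom I u" "Cod I u" v "Cod I v"] by (simp add: Hom_def)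
  moreover have "ar (v \<cdot>\<^bsub>I\<^esub> u) = ar v \<cdot>\<^bsub>C\<^esub> ar u" if "u \<in> Ar I" "v \<in> Ar I" "Cod I u = Dom I v" for u v
    using assms(4)[of u "Dom I u" "Cod I u" v "Cod I v"] that I.Dom_in I.Cod_in by (simp add: Hom_def)
  ultimately show ?thesis
    using assms(1-3) I.Dom_in I.Cod_in
    by (auto simp: functor_category_Ob_iff is_functor_def HomI HomD(1))
qed

text \<open>For kernels and biproducts, \<open>R\<close> says that an arrow commutes with the chosen kernel
  inclusions, respectively with the chosen projections.\<close>

lemma ex_functr_of_ex1:
  assumes I: "category I" and C: "category C"
    and ob: "\<And>i. i \<in> Ob I \<Longrightarrow> ob i \<in> Ob C"
    and ex1: "\<And>u i j. u \<in> Hom I i j \<Longrightarrow> i \<in> Ob I \<Longrightarrow> j \<in> Ob I \<Longrightarrow> \<exists>!m. m \<in> Hom C (ob i) (ob j) \<and> R i j u m"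
    and R_Ident: "\<And>i. i \<in> Ob I \<Longrightarrow> R i i (Ident I i) (Ident C (ob i))"
    and R_Comp: "\<And>u v i j k m n. u \<in> Hom I i j \<Longrightarrow> v \<in> Hom I j k \<Longrightarrow> i \<in> Ob I \<Longrightarrow> j \<in> Ob I \<Longrightarrow> k \<in> Ob I \<Longrightarrow>
      m \<in> Hom C (ob i) (ob j) \<Longrightarrow> n \<in> Hom C (ob j) (ob k) \<Longrightarrow> R i j u m \<Longrightarrow> R j k v n \<Longrightarrow>
      R i k (v \<cdot>\<^bsub>I\<^esub> u) (n \<cdot>\<^bsub>C\<^esub> m)"
  shows "\<exists>A\<in>Ob (functor_category I C).
    (\<forall>i\<in>Ob I. omap A i = ob i) \<and> (\<forall>i j. \<forall>u\<in>Hom I i j. R i j u (amap A u))"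
proof -
  interpret I: category I by (rule I)
  interpret C: category C by (rule C)
  \<comment> \<open>Structure maps are definite descriptions, so no coherence of choices is at
    stake: in each functor law both sides satisfy \<open>R\<close> over the same arrow of
    \<open>I\<close> and coincide by uniqueness.\<close>
  define ar where "ar u = (THE m. m \<in> Hom C (ob (Dom I u)) (ob (Cod I u)) \<and> R (Dom I u) (Cod I u) u m)" for u
  have ar: "ar u \<in> Hom C (ob i) (ob j)" "R i j u (ar u)" if "u \<in> Hom I i j" for u i j
    using theI'[OF ex1[OF that I.Hom_Ob[OF that]]] HomD[OF that] by (simp_all add: ar_def)
  have uniq: "m = n" if "u \<in> Hom I i j" "m \<in> Hom C (ob i) (ob j)" "R i j u m"
    "n \<in> Hom C (ob i) (ob j)" "R i j u n" for u i j m n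
    using ex1[OF that(1) I.Hom_Ob[OF that(1)]] that by (elim ex1E) metis
  let ?A = "\<lparr>omap = restrict ob (Ob I), amap = restrict ar (Ar I)\<rparr>"
  have "?A \<in> Ob (functor_category I C)"
  proof (rule functr_in_ObI[OF ob ar(1) _ _ I])
    fix i assume i: "i \<in> Ob I"
    show "ar (Ident I i) = Ident C (ob i)"
      by (rule uniq[OF I.Ident_in[OF i] ar[OF I.Ident_in[OF i]] C.Ident_in[OF ob[OF i]] R_Ident[OF i]])
  next
    fix u v i j k assume u: "u \<in> Hom I i j" and v: "v \<in> Hom I j k"
    note uv = I.Comp_in[OF u v]
    show "ar (v \<cdot>\<^bsub>I\<^esub> u) = ar v \<cdot>\<^bsub>C\<^esub> ar u"
      by (rule uniq[OF uv ar[OF uv] C.Comp_in[OF ar(1)[OF u] ar(1)[OF v]]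
            R_Comp[OF u v I.Hom_Ob[OF u] I.Hom_Ob(2)[OF v] ar(1)[OF u] ar(1)[OF v] ar(2)[OF u] ar(2)[OF v]]])
  qed
  moreover have "\<forall>i\<in>Ob I. omap ?A i = ob i" by simp
  moreover have "\<forall>i j. \<forall>u\<in>Hom I i j. R i j u (amap ?A u)" using ar(2) by (simp add: HomD(1))
  ultimately show ?thesis by blast
qed

text \<open>In the opposite of a functor category the arrows are unchanged records read backwards,
  while an arrow between functors on the opposite categories has its two fields exchanged. This map
  translates between them; on objects nothing changes, since a functor record is the same for both
  directions.\<close>

definition op_ntr :: "('i, 'j, 'o, 'm) ntr \<Rightarrow> ('i, 'j, 'o, 'm) ntr" where
  "op_ntr \<phi> = \<lparr>src = tgt \<phi>, tgt = src \<phi>, cmp = cmp \<phi>\<rparr>"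

lemma op_ntr_simps [simp]:
  "src (op_ntr \<phi>) = tgt \<phi>" "tgt (op_ntr \<phi>) = src \<phi>" "cmp (op_ntr \<phi>) = cmp \<phi>" "op_ntr (op_ntr \<phi>) = \<phi>"
  by (simp_all add: op_ntr_def)

lemma is_functor_op: "is_functor (op_cat I) (op_addcat C) A \<longleftrightarrow> is_functor I C A"
  unfolding is_functor_def op_cat_simps op_addcat_simps by (intro conj_cong refl) metis

lemma Ob_functor_category_op:
  "Ob (functor_category (op_cat I) (op_addcat C)) = Ob (functor_category I C)"
  by (intro Set.set_eqI) (simp add: functor_category_Ob_iff is_functor_op)

lemma is_nat_trans_op: "is_nat_trans (op_cat I) (op_addcat C) B A \<tau> \<longleftrightarrow> is_nat_trans I C A B \<tau>"
  unfolding is_nat_trans_def op_cat_simps op_addcat_simps by (intro conj_cong refl) metis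

lemma op_ntr_in_Hom_iff:
  "op_ntr \<phi> \<in> Hom (functor_category (op_cat I) (op_addcat C)) B A \<longleftrightarrow> \<phi> \<in> Hom (functor_category I C) A B"
  by (auto simp: functor_category_Hom_iff Ob_functor_category_op is_nat_trans_op)

lemma op_ntr_in_Ar_iff:
  "op_ntr \<phi> \<in> Ar (functor_category (op_cat I) (op_addcat C)) \<longleftrightarrow> \<phi> \<in> Ar (functor_category I C)"
  by (auto simp: functor_category_Ar_iff Ob_functor_category_op is_nat_trans_op)

text \<open>\<open>\<phi>\<close> is invertible and fixes objects. A test arrow in \<open>Y\<close>
  is carried to \<open>X\<close> by \<open>\<psi>\<close>, factored there, and the factor is carried
  back; composition and zero arrows, on which the kernel property rests, are preserved.\<close>

lemma is_kernel_transport: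
  assumes X: "preadditive_category X" and Y: "preadditive_category Y"
    and \<phi>: "\<And>f A B. f \<in> Hom X A B \<Longrightarrow> \<phi> f \<in> Hom Y A B"
    and \<psi>: "\<And>f A B. f \<in> Hom Y A B \<Longrightarrow> \<psi> f \<in> Hom X A B"
    and \<phi>\<psi>: "\<And>f. \<phi> (\<psi> f) = f" and \<psi>\<phi>: "\<And>f. \<psi> (\<phi> f) = f"
    and Comp: "\<And>f g. \<phi> (g \<cdot>\<^bsub>X\<^esub> f) = \<phi> g \<cdot>\<^bsub>Y\<^esub> \<phi> f"
    and Zero: "\<And>A B. \<phi> (Zero X A B) = Zero Y A B"
    and k: "is_kernel X k f"
  shows "is_kernel Y (\<phi> k) (\<phi> f)"
proof -
  interpret X: preadditive_category X by (rule X)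
  interpret Y: preadditive_category Y by (rule Y)
  note kf = X.is_kernel_Hom[OF k]
  show ?thesis
  proof (rule Y.is_kernelI[OF \<phi>[OF kf(1)] \<phi>[OF kf(2)]])
    show "\<phi> f \<cdot>\<^bsub>Y\<^esub> \<phi> k = Zero Y (Dom X k) (Cod X f)"
      using kf(3) by (simp only: Comp[symmetric] Zero)
    show "\<exists>u\<in>Hom Y W (Dom X k). \<phi> k \<cdot>\<^bsub>Y\<^esub> u = h"
      if h: "h \<in> Hom Y W (Dom X f)" and z: "\<phi> f \<cdot>\<^bsub>Y\<^esub> h = Zero Y W (Cod X f)" for W h
    proof -
      have "\<phi> (f \<cdot>\<^bsub>X\<^esub> \<psi> h) = \<phi> (Zero X W (Cod X f))"
        using z by (simp only: Comp Zero \<phi>\<psi>)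
      then have "f \<cdot>\<^bsub>X\<^esub> \<psi> h = Zero X W (Cod X f)" by (metis \<psi>\<phi>)
      from X.is_kernel_factor[OF k \<psi>[OF h] this]
      obtain u where "u \<in> Hom X W (Dom X k)" "k \<cdot>\<^bsub>X\<^esub> u = \<psi> h" by metis
      then show ?thesis by (metis \<phi> Comp \<phi>\<psi>)
    qed
    show "u = v" if u: "u \<in> Hom Y W (Dom X k)" and v: "v \<in> Hom Y W (Dom X k)"
      and eq: "\<phi> k \<cdot>\<^bsub>Y\<^esub> u = \<phi> k \<cdot>\<^bsub>Y\<^esub> v" for W u v
    proof -
      have "\<phi> (k \<cdot>\<^bsub>X\<^esub> \<psi> u) = \<phi> (k \<cdot>\<^bsub>X\<^esub> \<psi> v)" using eq by (simp only: Comp \<phi>\<psi>)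
      then have "k \<cdot>\<^bsub>X\<^esub> \<psi> u = k \<cdot>\<^bsub>X\<^esub> \<psi> v" by (metis \<psi>\<phi>)
      from X.is_kernel_cancel[OF k \<psi>[OF u] \<psi>[OF v] this] show "u = v" by (metis \<phi>\<psi>)
    qed
  qed
qed

section \<open>The preadditive structure of functor categories\<close>

locale functor_categories = I: category I + C: abelian_category C
  for I :: "('i, 'j) cat" and C :: "('o, 'm) addcat"
begin

abbreviation E where "E \<equiv> functor_category I C"

lemma cmp_Comp: "i \<in> Ob I \<Longrightarrow> cmp (\<psi> \<cdot>\<^bsub>E\<^esub> \<phi>) i = cmp \<psi> i \<cdot>\<^bsub>C\<^esub> cmp \<phi> i"
  by (simp add: functor_category_simps)

lemma cmp_Zero: "i \<in> Ob I \<Longrightarrow> cmp (Zero E A B) i = Zero C (omap A i) (omap B i)"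
  by (simp add: functor_category_simps)

lemma cmp_Add: "i \<in> Ob I \<Longrightarrow> cmp (Add E \<phi> \<psi>) i = Add C (cmp \<phi> i) (cmp \<psi> i)"
  by (simp add: functor_category_simps)

lemma cmp_Ident: "i \<in> Ob I \<Longrightarrow> cmp (Ident E A) i = Ident C (omap A i)"
  by (simp add: functor_category_simps)

lemma Ident_in_E:
  assumes "A \<in> Ob E"
  shows "Ident E A \<in> Hom E A A"
  unfolding functor_category_simps
  using assms C.Ident_in[OF omap_in[OF assms]] C.Comp_Ident[OF amap_in[OF assms]]
    C.Ident_Comp[OF amap_in[OF assms]]
  by (intro ntr_in_HomI) (auto simp: I.category_axioms)

lemma Zero_in_E:
  assumes "A \<in> Ob E" "B \<in> Ob E"
  shows "Zero E A B \<in> Hom E A B"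
  unfolding functor_category_simps
proof (rule ntr_in_HomI[OF assms _ _ I.category_axioms])
  show "Zero C (omap A i) (omap B i) \<in> Hom C (omap A i) (omap B i)" if "i \<in> Ob I" for i
    using C.Zero_in[OF omap_in[OF assms(1) that] omap_in[OF assms(2) that]] .
  show "Zero C (omap A j) (omap B j) \<cdot>\<^bsub>C\<^esub> amap A u = amap B u \<cdot>\<^bsub>C\<^esub> Zero C (omap A i) (omap B i)"
    if "u \<in> Hom I i j" "i \<in> Ob I" "j \<in> Ob I" for u i j
    using C.Zero_Comp[OF amap_in[OF assms(1) that(1)] omap_in[OF assms(2) that(3)]]
      C.Comp_Zero[OF amap_in[OF assms(2) that(1)] omap_in[OF assms(1) that(2)]] by simp
qed

lemma Hom_E_Ob: "\<phi> \<in> Hom E A B \<Longrightarrow> A \<in> Ob E" "\<phi> \<in> Hom E A B \<Longrightarrow> B \<in> Ob E"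
  by (simp_all add: functor_category_Hom_iff)

lemma Comp_in_E:
  assumes f: "\<phi> \<in> Hom E A B" and g: "\<psi> \<in> Hom E B G"
  shows "\<psi> \<cdot>\<^bsub>E\<^esub> \<phi> \<in> Hom E A G"
proof -
  note O = Hom_E_Ob[OF f] Hom_E_Ob[OF g]
  have "src \<phi> = A" "tgt \<psi> = G" using f g by (simp_all add: functor_category_Hom_iff)
  then show ?thesis
    unfolding functor_category_simps
  proof (simp only:, intro ntr_in_HomI[OF O(1,4) _ _ I.category_axioms])
    show "cmp \<psi> i \<cdot>\<^bsub>C\<^esub> cmp \<phi> i \<in> Hom C (omap A i) (omap G i)" if "i \<in> Ob I" for i
      using C.Comp_in[OF cmp_in[OF f that] cmp_in[OF g that]] .
    fix u i j assume u: "u \<in> Hom I i j" and i: "i \<in> Ob I" and j: "j \<in> Ob I"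
    have "(cmp \<psi> j \<cdot>\<^bsub>C\<^esub> cmp \<phi> j) \<cdot>\<^bsub>C\<^esub> amap A u = cmp \<psi> j \<cdot>\<^bsub>C\<^esub> (amap B u \<cdot>\<^bsub>C\<^esub> cmp \<phi> i)"
      using C.Comp_assoc[OF amap_in[OF O(1) u] cmp_in[OF f j] cmp_in[OF g j]] cmp_natural[OF f u] by simp
    also have "\<dots> = (amap G u \<cdot>\<^bsub>C\<^esub> cmp \<psi> i) \<cdot>\<^bsub>C\<^esub> cmp \<phi> i"
      using C.Comp_assoc[OF cmp_in[OF f i] amap_in[OF O(3) u] cmp_in[OF g j]] cmp_natural[OF g u] by simp
    also have "\<dots> = amap G u \<cdot>\<^bsub>C\<^esub> (cmp \<psi> i \<cdot>\<^bsub>C\<^esub> cmp \<phi> i)"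
      using C.Comp_assoc[OF cmp_in[OF f i] cmp_in[OF g i] amap_in[OF O(4) u]] .
    finally show "(cmp \<psi> j \<cdot>\<^bsub>C\<^esub> cmp \<phi> j) \<cdot>\<^bsub>C\<^esub> amap A u = amap G u \<cdot>\<^bsub>C\<^esub> (cmp \<psi> i \<cdot>\<^bsub>C\<^esub> cmp \<phi> i)" .
  qed
qed

lemma Add_in_E:
  assumes f: "\<phi> \<in> Hom E A B" and g: "\<psi> \<in> Hom E A B"
  shows "Add E \<phi> \<psi> \<in> Hom E A B"
proof -
  note O = Hom_E_Ob[OF f]
  have "src \<phi> = A" "tgt \<phi> = B" using f by (simp_all add: functor_category_Hom_iff)
  then show ?thesis
    unfolding functor_category_simps
  proof (simp only:, intro ntr_in_HomI[OF O _ _ I.category_axioms])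
    show "Add C (cmp \<phi> i) (cmp \<psi> i) \<in> Hom C (omap A i) (omap B i)" if "i \<in> Ob I" for i
      using C.Add_in[OF cmp_in[OF f that] cmp_in[OF g that]] .
    fix u i j assume u: "u \<in> Hom I i j" and i: "i \<in> Ob I" and j: "j \<in> Ob I"
    show "Add C (cmp \<phi> j) (cmp \<psi> j) \<cdot>\<^bsub>C\<^esub> amap A u = amap B u \<cdot>\<^bsub>C\<^esub> Add C (cmp \<phi> i) (cmp \<psi> i)"
      using C.Comp_Add_left[OF amap_in[OF O(1) u] cmp_in[OF f j] cmp_in[OF g j]]
        C.Comp_Add_right[OF cmp_in[OF f i] cmp_in[OF g i] amap_in[OF O(2) u]]
        cmp_natural[OF f u] cmp_natural[OF g u] by simp
  qed
qed

text \<open>Negatives are chosen pointwise, and their uniqueness makes the choice natural: both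
  sides of the naturality square are negatives of the composite of \<open>cmp \<phi> j\<close> with
  \<open>amap A u\<close>.\<close>

lemma ex_negative_E:
  assumes f: "\<phi> \<in> Hom E A B"
  shows "\<exists>\<psi>\<in>Hom E A B. Add E \<psi> \<phi> = Zero E A B"
proof -
  note O = Hom_E_Ob[OF f]
  have "\<exists>t. \<forall>i\<in>Ob I. t i \<in> Hom C (omap A i) (omap B i) \<and> Add C (t i) (cmp \<phi> i) = Zero C (omap A i) (omap B i)"
    by (rule bchoice) (metis C.ex_negative cmp_in[OF f])
  then obtain t where t: "\<And>i. i \<in> Ob I \<Longrightarrow> t i \<in> Hom C (omap A i) (omap B i)"
    "\<And>i. i \<in> Ob I \<Longrightarrow> Add C (t i) (cmp \<phi> i) = Zero C (omap A i) (omap B i)" by blast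
  let ?t = "\<lparr>src = A, tgt = B, cmp = restrict t (Ob I)\<rparr>"
  have t_in: "?t \<in> Hom E A B"
  proof (rule ntr_in_HomI[OF O t(1) _ I.category_axioms])
    fix u i j assume u: "u \<in> Hom I i j" and i: "i \<in> Ob I" and j: "j \<in> Ob I"
    note A = amap_in[OF O(1) u] and B = amap_in[OF O(2) u]
    have "Add C (t j \<cdot>\<^bsub>C\<^esub> amap A u) (cmp \<phi> j \<cdot>\<^bsub>C\<^esub> amap A u) = Zero C (omap A i) (omap B j)"
      using C.Comp_Add_left[OF A t(1)[OF j] cmp_in[OF f j]] t(2)[OF j]
        C.Zero_Comp[OF A omap_in[OF O(2) j]] by simp
    also have "\<dots> = Add C (amap B u \<cdot>\<^bsub>C\<^esub> t i) (cmp \<phi> j \<cdot>\<^bsub>C\<^esub> amap A u)"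
      using C.Comp_Add_right[OF t(1)[OF i] cmp_in[OF f i] B] t(2)[OF i] cmp_natural[OF f u]
        C.Comp_Zero[OF B omap_in[OF O(1) i]] by simp
    finally show "t j \<cdot>\<^bsub>C\<^esub> amap A u = amap B u \<cdot>\<^bsub>C\<^esub> t i"
      using C.Add_right_cancel[OF C.Comp_in[OF A t(1)[OF j]] C.Comp_in[OF t(1)[OF i] B]
          C.Comp_in[OF A cmp_in[OF f j]]] by simp
  qed
  have "Add E ?t \<phi> = Zero E A B"
    by (rule ntr_eqI[OF Add_in_E[OF t_in f] Zero_in_E[OF O]]) (simp add: cmp_Add cmp_Zero t(2))
  with t_in show ?thesis by blast
qed

lemma category_E: "category E"
proof (rule category.intro)
  fix f assume "f \<in> Ar E"
  then show "Dom E f \<in> Ob E" "Cod E f \<in> Ob E"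
    by (simp_all add: functor_category_Ar_iff functor_category_simps)
next
  fix f X Y assume f: "f \<in> Hom E X Y"
  note O = Hom_E_Ob[OF f]
  show "f \<cdot>\<^bsub>E\<^esub> Ident E X = f"
    by (rule ntr_eqI[OF Comp_in_E[OF Ident_in_E[OF O(1)] f] f])
      (simp add: cmp_Comp cmp_Ident C.Comp_Ident[OF cmp_in[OF f]])
  show "Ident E Y \<cdot>\<^bsub>E\<^esub> f = f"
    by (rule ntr_eqI[OF Comp_in_E[OF f Ident_in_E[OF O(2)]] f])
      (simp add: cmp_Comp cmp_Ident C.Ident_Comp[OF cmp_in[OF f]])
next
  fix f g h W X Y Z assume f: "f \<in> Hom E W X" and g: "g \<in> Hom E X Y" and h: "h \<in> Hom E Y Z"
  show "(h \<cdot>\<^bsub>E\<^esub> g) \<cdot>\<^bsub>E\<^esub> f = h \<cdot>\<^bsub>E\<^esub> (g \<cdot>\<^bsub>E\<^esub> f)"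
    by (rule ntr_eqI[OF Comp_in_E[OF f Comp_in_E[OF g h]] Comp_in_E[OF Comp_in_E[OF f g] h]])
      (simp add: cmp_Comp C.Comp_assoc[OF cmp_in[OF f] cmp_in[OF g] cmp_in[OF h]])
qed (fact Ident_in_E Comp_in_E)+

sublocale E: preadditive_category "functor_category I C"
proof (rule preadditive_category.intro[OF category_E], rule preadditive_category_axioms.intro)
  fix A B assume O: "A \<in> Ob E" "B \<in> Ob E"
  show "comm_group (hom_group E A B)"
  proof (rule comm_groupI, unfold hom_group_def monoid.simps partial_object.simps)
    fix f g h assume f: "f \<in> Hom E A B" and g: "g \<in> Hom E A B" and h: "h \<in> Hom E A B"
    show "Add E (Add E f g) h = Add E f (Add E g h)"
      by (rule ntr_eqI[OF Add_in_E[OF Add_in_E[OF f g] h] Add_in_E[OF f Add_in_E[OF g h]]])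
        (simp add: cmp_Add C.Add_assoc[OF cmp_in[OF f] cmp_in[OF g] cmp_in[OF h]])
  next
    fix f g assume f: "f \<in> Hom E A B" and g: "g \<in> Hom E A B"
    show "Add E f g = Add E g f"
      by (rule ntr_eqI[OF Add_in_E[OF f g] Add_in_E[OF g f]])
        (simp add: cmp_Add C.Add_commute[OF cmp_in[OF f] cmp_in[OF g]])
  next
    fix f assume f: "f \<in> Hom E A B"
    show "Add E (Zero E A B) f = f"
      by (rule ntr_eqI[OF Add_in_E[OF Zero_in_E[OF O] f] f])
        (simp add: cmp_Add cmp_Zero C.Add_Zero_left[OF cmp_in[OF f]])
  qed (fact Add_in_E Zero_in_E[OF O] ex_negative_E)+
next
  fix f g g' X Y Z assume f: "f \<in> Hom E X Y" and g: "g \<in> Hom E Y Z" and g': "g' \<in> Hom E Y Z"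
  show "Add E g g' \<cdot>\<^bsub>E\<^esub> f = Add E (g \<cdot>\<^bsub>E\<^esub> f) (g' \<cdot>\<^bsub>E\<^esub> f)"
    by (rule ntr_eqI[OF Comp_in_E[OF f Add_in_E[OF g g']] Add_in_E[OF Comp_in_E[OF f g] Comp_in_E[OF f g']]])
      (simp add: cmp_Add cmp_Comp C.Comp_Add_left[OF cmp_in[OF f] cmp_in[OF g] cmp_in[OF g']])
next
  fix f f' g X Y Z assume f: "f \<in> Hom E X Y" and f': "f' \<in> Hom E X Y" and g: "g \<in> Hom E Y Z"
  show "g \<cdot>\<^bsub>E\<^esub> Add E f f' = Add E (g \<cdot>\<^bsub>E\<^esub> f) (g \<cdot>\<^bsub>E\<^esub> f')"
    by (rule ntr_eqI[OF Comp_in_E[OF Add_in_E[OF f f'] g] Add_in_E[OF Comp_in_E[OF f g] Comp_in_E[OF f' g]]])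
      (simp add: cmp_Add cmp_Comp C.Comp_Add_right[OF cmp_in[OF f] cmp_in[OF f'] cmp_in[OF g]])
qed


section \<open>Kernels and cokernels in functor categories\<close>

text \<open>The pointwise factorizations of \<open>h\<close> are unique and therefore natural: the
  two sides of the square at \<open>u\<close> agree after the monic \<open>cmp k j\<close>.\<close>

lemma pointwise_kernelI:
  assumes k: "k \<in> Hom E K A" and f: "f \<in> Hom E A B"
    and ker: "\<And>i. i \<in> Ob I \<Longrightarrow> is_kernel C (cmp k i) (cmp f i)"
  shows "is_kernel E k f"
proof (rule E.is_kernelI[OF k f])
  note k_simps = HomD[OF cmp_in[OF k]] and f_simps = HomD[OF cmp_in[OF f]]
  show "f \<cdot>\<^bsub>E\<^esub> k = Zero E K B"
    by (rule ntr_eqI[OF E.Comp_in[OF k f] E.Zero_in[OF Hom_E_Ob(1)[OF k] Hom_E_Ob(2)[OF f]]])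
      (simp add: cmp_Comp cmp_Zero C.is_kernel_Hom(3)[OF ker] k_simps f_simps)
  show "u = v" if u: "u \<in> Hom E W K" and v: "v \<in> Hom E W K" and eq: "k \<cdot>\<^bsub>E\<^esub> u = k \<cdot>\<^bsub>E\<^esub> v" for W u v
  proof (rule ntr_eqI[OF u v])
    fix i assume i: "i \<in> Ob I"
    have "cmp k i \<cdot>\<^bsub>C\<^esub> cmp u i = cmp k i \<cdot>\<^bsub>C\<^esub> cmp v i"
      using arg_cong[OF eq, of "\<lambda>\<phi>. cmp \<phi> i"] by (simp add: cmp_Comp i)
    with C.is_kernel_cancel[OF ker[OF i], unfolded k_simps[OF i], OF cmp_in[OF u i] cmp_in[OF v i]]
    show "cmp u i = cmp v i" by simp
  qed
  fix W h assume h: "h \<in> Hom E W A" and z: "f \<cdot>\<^bsub>E\<^esub> h = Zero E W B"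
  have "\<exists>t. \<forall>i\<in>Ob I. t i \<in> Hom C (omap W i) (omap K i) \<and> cmp k i \<cdot>\<^bsub>C\<^esub> t i = cmp h i"
  proof (rule bchoice, rule ballI)
    fix i assume i: "i \<in> Ob I"
    have "cmp f i \<cdot>\<^bsub>C\<^esub> cmp h i = Zero C (omap W i) (omap B i)"
      using arg_cong[OF z, of "\<lambda>\<phi>. cmp \<phi> i"] by (simp add: cmp_Comp cmp_Zero i)
    from C.is_kernel_factor[OF ker[OF i], unfolded k_simps[OF i] f_simps[OF i], OF cmp_in[OF h i] this]
    show "\<exists>t. t \<in> Hom C (omap W i) (omap K i) \<and> cmp k i \<cdot>\<^bsub>C\<^esub> t = cmp h i" by metis
  qed
  then obtain t where t: "\<And>i. i \<in> Ob I \<Longrightarrow> t i \<in> Hom C (omap W i) (omap K i)"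
    "\<And>i. i \<in> Ob I \<Longrightarrow> cmp k i \<cdot>\<^bsub>C\<^esub> t i = cmp h i" by metis
  let ?t = "\<lparr>src = W, tgt = K, cmp = restrict t (Ob I)\<rparr>"
  have t_in: "?t \<in> Hom E W K"
  proof (rule ntr_in_HomI[OF Hom_E_Ob(1)[OF h] Hom_E_Ob(1)[OF k] t(1) _ I.category_axioms])
    fix u i j assume u: "u \<in> Hom I i j" and i: "i \<in> Ob I" and j: "j \<in> Ob I"
    note Wu = amap_in[OF Hom_E_Ob(1)[OF h] u] and Ku = amap_in[OF Hom_E_Ob(1)[OF k] u]
      and Au = amap_in[OF Hom_E_Ob(2)[OF h] u]
    have "cmp k j \<cdot>\<^bsub>C\<^esub> (t j \<cdot>\<^bsub>C\<^esub> amap W u) = amap A u \<cdot>\<^bsub>C\<^esub> cmp h i"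
      using C.Comp_assoc[OF Wu t(1)[OF j] cmp_in[OF k j]] t(2)[OF j] cmp_natural[OF h u] by simp
    also have "\<dots> = (amap A u \<cdot>\<^bsub>C\<^esub> cmp k i) \<cdot>\<^bsub>C\<^esub> t i"
      using C.Comp_assoc[OF t(1)[OF i] cmp_in[OF k i] Au] t(2)[OF i] by simp
    also have "\<dots> = cmp k j \<cdot>\<^bsub>C\<^esub> (amap K u \<cdot>\<^bsub>C\<^esub> t i)"
      using C.Comp_assoc[OF t(1)[OF i] Ku cmp_in[OF k j]] cmp_natural[OF k u] by simp
    finally show "t j \<cdot>\<^bsub>C\<^esub> amap W u = amap K u \<cdot>\<^bsub>C\<^esub> t i"
      by (rule C.is_kernel_cancel[OF ker[OF j], unfolded k_simps[OF j],
            OF C.Comp_in[OF Wu t(1)[OF j]] C.Comp_in[OF t(1)[OF i] Ku]])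
  qed
  have "k \<cdot>\<^bsub>E\<^esub> ?t = h"
    by (rule ntr_eqI[OF E.Comp_in[OF t_in k] h]) (simp add: cmp_Comp t(2))
  with t_in show "\<exists>u\<in>Hom E W K. k \<cdot>\<^bsub>E\<^esub> u = h" by blast
qed

text \<open>The relation handed to \<open>ex_functr_of_ex1\<close> is the naturality square of the
  chosen inclusions, so the functor it produces comes with a natural inclusion into
  \<open>A\<close>.\<close>

lemma ex_pointwise_kernel:
  assumes f: "f \<in> Hom E A B"
  obtains K k where "k \<in> Hom E K A" "\<And>i. i \<in> Ob I \<Longrightarrow> is_kernel C (cmp k i) (cmp f i)"
proof -
  note f_simps = HomD[OF cmp_in[OF f]]
  have "\<exists>\<kappa>. \<forall>i\<in>Ob I. is_kernel C (\<kappa> i) (cmp f i)"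
    by (rule bchoice) (auto intro: C.ex_kernel f_simps(1))
  then obtain \<kappa> where ker: "\<And>i. i \<in> Ob I \<Longrightarrow> is_kernel C (\<kappa> i) (cmp f i)" by metis
  have \<kappa>: "\<kappa> i \<in> Hom C (Dom C (\<kappa> i)) (omap A i)"
    "cmp f i \<cdot>\<^bsub>C\<^esub> \<kappa> i = Zero C (Dom C (\<kappa> i)) (omap B i)" if "i \<in> Ob I" for i
    using C.is_kernel_Hom[OF ker[OF that]] f_simps[OF that] by simp_all
  note Au = amap_in[OF Hom_E_Ob(1)[OF f]] and Bu = amap_in[OF Hom_E_Ob(2)[OF f]]
  have "\<exists>K\<in>Ob E. (\<forall>i\<in>Ob I. omap K i = Dom C (\<kappa> i)) \<and>
    (\<forall>i j. \<forall>u\<in>Hom I i j. \<kappa> j \<cdot>\<^bsub>C\<^esub> amap K u = amap A u \<cdot>\<^bsub>C\<^esub> \<kappa> i)"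
  proof (rule ex_functr_of_ex1[OF I.category_axioms C.category_axioms,
        where ob = "\<lambda>i. Dom C (\<kappa> i)" and R = "\<lambda>i j u m. \<kappa> j \<cdot>\<^bsub>C\<^esub> m = amap A u \<cdot>\<^bsub>C\<^esub> \<kappa> i"])
    fix i assume i: "i \<in> Ob I"
    show "Dom C (\<kappa> i) \<in> Ob C" using C.Hom_Ob(1)[OF \<kappa>(1)[OF i]] .
    show "\<kappa> i \<cdot>\<^bsub>C\<^esub> Ident C (Dom C (\<kappa> i)) = amap A (Ident I i) \<cdot>\<^bsub>C\<^esub> \<kappa> i"
      using C.Comp_Ident[OF \<kappa>(1)[OF i]] C.Ident_Comp[OF \<kappa>(1)[OF i]]
        amap_Ident[OF Hom_E_Ob(1)[OF f] i] by simp
  next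
    fix u i j assume u: "u \<in> Hom I i j" and i: "i \<in> Ob I" and j: "j \<in> Ob I"
    \<comment> \<open>By naturality of \<open>f\<close>, the restriction of \<open>amap A u\<close>
      to the kernel at \<open>i\<close> is killed by \<open>cmp f j\<close>; its unique
      factorization through \<open>\<kappa> j\<close> is the structure map at
      \<open>u\<close>.\<close>
    have "cmp f j \<cdot>\<^bsub>C\<^esub> (amap A u \<cdot>\<^bsub>C\<^esub> \<kappa> i) = amap B u \<cdot>\<^bsub>C\<^esub> (cmp f i \<cdot>\<^bsub>C\<^esub> \<kappa> i)"
      using C.Comp_assoc[OF \<kappa>(1)[OF i] Au[OF u] cmp_in[OF f j]]
        C.Comp_assoc[OF \<kappa>(1)[OF i] cmp_in[OF f i] Bu[OF u]] cmp_natural[OF f u] by simp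
    then have "cmp f j \<cdot>\<^bsub>C\<^esub> (amap A u \<cdot>\<^bsub>C\<^esub> \<kappa> i) = Zero C (Dom C (\<kappa> i)) (omap B j)"
      using \<kappa>(2)[OF i] C.Comp_Zero[OF Bu[OF u] C.Hom_Ob(1)[OF \<kappa>(1)[OF i]]] by simp
    then show "\<exists>!m. m \<in> Hom C (Dom C (\<kappa> i)) (Dom C (\<kappa> j)) \<and> \<kappa> j \<cdot>\<^bsub>C\<^esub> m = amap A u \<cdot>\<^bsub>C\<^esub> \<kappa> i"
      by (rule C.is_kernel_ex1[OF ker[OF j], unfolded f_simps[OF j], OF C.Comp_in[OF \<kappa>(1)[OF i] Au[OF u]]])
  next
    fix u v i j k m n assume u: "u \<in> Hom I i j" and v: "v \<in> Hom I j k"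
      and i: "i \<in> Ob I" and j: "j \<in> Ob I" and k: "k \<in> Ob I"
      and m: "m \<in> Hom C (Dom C (\<kappa> i)) (Dom C (\<kappa> j))" and n: "n \<in> Hom C (Dom C (\<kappa> j)) (Dom C (\<kappa> k))"
      and eq: "\<kappa> j \<cdot>\<^bsub>C\<^esub> m = amap A u \<cdot>\<^bsub>C\<^esub> \<kappa> i" "\<kappa> k \<cdot>\<^bsub>C\<^esub> n = amap A v \<cdot>\<^bsub>C\<^esub> \<kappa> j"
    have "\<kappa> k \<cdot>\<^bsub>C\<^esub> (n \<cdot>\<^bsub>C\<^esub> m) = amap A v \<cdot>\<^bsub>C\<^esub> (\<kappa> j \<cdot>\<^bsub>C\<^esub> m)"
      using C.Comp_assoc[OF m n \<kappa>(1)[OF k]] C.Comp_assoc[OF m \<kappa>(1)[OF j] Au[OF v]] eq(2) by simp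
    also have "\<dots> = amap A (v \<cdot>\<^bsub>I\<^esub> u) \<cdot>\<^bsub>C\<^esub> \<kappa> i"
      using C.Comp_assoc[OF \<kappa>(1)[OF i] Au[OF u] Au[OF v]] amap_Comp[OF Hom_E_Ob(1)[OF f] u v] eq(1) by simp
    finally show "\<kappa> k \<cdot>\<^bsub>C\<^esub> (n \<cdot>\<^bsub>C\<^esub> m) = amap A (v \<cdot>\<^bsub>I\<^esub> u) \<cdot>\<^bsub>C\<^esub> \<kappa> i" .
  qed
  then obtain K where K: "K \<in> Ob E" "\<And>i. i \<in> Ob I \<Longrightarrow> omap K i = Dom C (\<kappa> i)"
    "\<And>u i j. u \<in> Hom I i j \<Longrightarrow> \<kappa> j \<cdot>\<^bsub>C\<^esub> amap K u = amap A u \<cdot>\<^bsub>C\<^esub> \<kappa> i"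
    by metis
  let ?k = "\<lparr>src = K, tgt = A, cmp = restrict \<kappa> (Ob I)\<rparr>"
  have "?k \<in> Hom E K A"
    by (rule ntr_in_HomI[OF K(1) Hom_E_Ob(1)[OF f] _ K(3) I.category_axioms]) (simp add: K(2) \<kappa>(1))
  then show thesis by (rule that) (simp add: ker)
qed

text \<open>From left to right, the given kernel is isomorphic to a pointwise one; an isomorphism of
  functors is an isomorphism at each \<open>i\<close>, along which \<open>is_kernel_iso\<close>
  moves the kernel property.\<close>

lemma is_kernel_E_iff:
  "is_kernel E k f \<longleftrightarrow> k \<in> Ar E \<and> f \<in> Ar E \<and> tgt k = src f \<and>
    (\<forall>i\<in>Ob I. is_kernel C (cmp k i) (cmp f i))"
proof (intro iffI conjI ballI)
  assume k: "is_kernel E k f"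
  show "k \<in> Ar E" "f \<in> Ar E" "tgt k = src f"
    using E.is_kernel_Hom(1,2)[OF k, THEN HomD(1)] E.is_kernel_Hom(1)[OF k, THEN HomD(3)]
    by (simp_all add: functor_category_simps)
  fix i assume i: "i \<in> Ob I"
  from ex_pointwise_kernel[OF E.is_kernel_Hom(2)[OF k]]
  obtain K' k' where k': "k' \<in> Hom E K' (Dom E f)" "\<And>i. i \<in> Ob I \<Longrightarrow> is_kernel C (cmp k' i) (cmp f i)"
    by metis
  obtain u v where u: "u \<in> Hom E (Dom E k) K'" "k' \<cdot>\<^bsub>E\<^esub> u = k" and v: "v \<in> Hom E K' (Dom E k)"
    and uv: "u \<cdot>\<^bsub>E\<^esub> v = Ident E K'" and vu: "v \<cdot>\<^bsub>E\<^esub> u = Ident E (Dom E k)"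
    using E.is_kernel_unique[OF pointwise_kernelI[OF k'(1) E.is_kernel_Hom(2)[OF k] k'(2)] k]
    unfolding HomD(2)[OF k'(1)] by metis
  have Dom_k': "Dom C (cmp k' i) = omap K' i" using HomD(2)[OF cmp_in[OF k'(1) i]] .
  have "is_kernel C (cmp k' i \<cdot>\<^bsub>C\<^esub> cmp u i) (cmp f i)"
  proof (rule C.is_kernel_iso[OF k'(2)[OF i], unfolded Dom_k', OF cmp_in[OF u(1) i] cmp_in[OF v i]])
    show "cmp u i \<cdot>\<^bsub>C\<^esub> cmp v i = Ident C (omap K' i)"
      using arg_cong[OF uv, of "\<lambda>\<phi>. cmp \<phi> i"] i by (simp add: cmp_Comp cmp_Ident)
    show "cmp v i \<cdot>\<^bsub>C\<^esub> cmp u i = Ident C (omap (Dom E k) i)"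
      using arg_cong[OF vu, of "\<lambda>\<phi>. cmp \<phi> i"] i by (simp add: cmp_Comp cmp_Ident)
  qed
  then show "is_kernel C (cmp k i) (cmp f i)"
    using arg_cong[OF u(2), of "\<lambda>\<phi>. cmp \<phi> i"] i by (simp add: cmp_Comp)
next
  assume a: "k \<in> Ar E \<and> f \<in> Ar E \<and> tgt k = src f \<and> (\<forall>i\<in>Ob I. is_kernel C (cmp k i) (cmp f i))"
  then show "is_kernel E k f"
    by (intro pointwise_kernelI[of k "src k" "src f" f "tgt f"])
      (simp_all add: Hom_def functor_category_simps)
qed

text \<open>Interpreting the locale at the opposites, under the prefix \<open>op\<close>, makes each
  result on kernels available a second time, to be read as one on cokernels.\<close>

lemma functor_categories_op: "functor_categories (op_cat I) (op_addcat C)"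
  by (rule functor_categories.intro[OF I.category_op_cat C.abelian_category_op])

text \<open>A cokernel is a kernel in the opposite of the functor category, which
  \<open>op_ntr\<close> identifies with the functor category of the opposites;
  \<open>is_kernel_transport\<close> is applied in both directions.\<close>

lemma is_cokernel_op_ntr:
  "is_cokernel E c f \<longleftrightarrow> is_kernel (functor_category (op_cat I) (op_addcat C)) (op_ntr c) (op_ntr f)"
proof -
  interpret op: functor_categories "op_cat I" "op_addcat C" by (rule functor_categories_op)
  note pre = E.preadditive_category_op op.E.preadditive_category_axioms
  note bij = op_ntr_in_Hom_iff[THEN iffD2]
    op_ntr_in_Hom_iff[where \<phi> = "op_ntr \<phi>" for \<phi>, unfolded op_ntr_simps, THEN iffD1]
  have "is_kernel (op_addcat E) (op_ntr (op_ntr c)) (op_ntr (op_ntr f))"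
    if k: "is_kernel op.E (op_ntr c) (op_ntr f)"
    by (rule is_kernel_transport[OF pre(2,1) _ _ _ _ _ _ k, where \<psi> = op_ntr]; (unfold op_addcat_simps)?)
      (erule bij | rule op_ntr_simps(4) | simp only: functor_category_simps op_addcat_simps op_cat_simps op_ntr_def ntr.simps)+
  moreover have "is_kernel op.E (op_ntr c) (op_ntr f)" if k: "is_kernel (op_addcat E) c f"
    by (rule is_kernel_transport[OF pre _ _ _ _ _ _ k, where \<psi> = op_ntr]; (unfold op_addcat_simps)?)
      (erule bij | rule op_ntr_simps(4) | simp only: functor_category_simps op_addcat_simps op_cat_simps op_ntr_def ntr.simps)+
  ultimately show ?thesis unfolding is_kernel_op op_ntr_simps by (rule iffI[rotated])
qed

lemma is_epi_op_ntr:
  assumes "is_epi E e"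
  shows "is_mono (functor_category (op_cat I) (op_addcat C)) (op_ntr e)"
  unfolding is_mono_def
proof (intro conjI allI ballI impI)
  interpret op: functor_categories "op_cat I" "op_addcat C" by (rule functor_categories_op)
  show "op_ntr e \<in> Ar op.E" using assms by (simp add: op_ntr_in_Ar_iff is_epi_def)
  fix X f g assume f: "f \<in> Hom op.E X (Dom op.E (op_ntr e))" and g: "g \<in> Hom op.E X (Dom op.E (op_ntr e))"
    and eq: "op_ntr e \<cdot>\<^bsub>op.E\<^esub> f = op_ntr e \<cdot>\<^bsub>op.E\<^esub> g"
  have "op_ntr f \<in> Hom E (Cod E e) X" "op_ntr g \<in> Hom E (Cod E e) X"
    using f g op_ntr_in_Hom_iff[of "op_ntr f"] op_ntr_in_Hom_iff[of "op_ntr g"]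
    by (simp_all add: functor_category_simps)
  moreover have "op_ntr f \<cdot>\<^bsub>E\<^esub> e = op_ntr g \<cdot>\<^bsub>E\<^esub> e"
    using arg_cong[OF eq, of op_ntr] by (simp add: functor_category_simps op_ntr_def)
  ultimately have "op_ntr f = op_ntr g" using assms unfolding is_epi_def by metis
  then show "f = g" by (metis op_ntr_simps(4))
qed

lemma is_cokernel_E_iff:
  "is_cokernel E c f \<longleftrightarrow> c \<in> Ar E \<and> f \<in> Ar E \<and> tgt f = src c \<and>
    (\<forall>i\<in>Ob I. is_cokernel C (cmp c i) (cmp f i))"
proof -
  interpret op: functor_categories "op_cat I" "op_addcat C" by (rule functor_categories_op)
  show ?thesis
    unfolding is_cokernel_op_ntr op.is_kernel_E_iff op_ntr_in_Ar_iff op_ntr_simps op_cat_simps is_kernel_op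
      eq_commute[of "tgt f" "src c"] ..
qed

lemma ex_kernel_E:
  assumes "f \<in> Ar E"
  shows "\<exists>k. is_kernel E k f"
  using ex_pointwise_kernel[OF HomI[OF assms]] pointwise_kernelI[OF _ HomI[OF assms]] by metis

lemma ex_cokernel_E:
  assumes "f \<in> Ar E"
  shows "\<exists>c. is_cokernel E c f"
proof -
  interpret op: functor_categories "op_cat I" "op_addcat C" by (rule functor_categories_op)
  obtain k where "is_kernel op.E k (op_ntr f)"
    using op.ex_kernel_E assms op_ntr_in_Ar_iff by metis
  then have "is_cokernel E (op_ntr k) f" unfolding is_cokernel_op_ntr op_ntr_simps .
  then show ?thesis ..
qed

text \<open>The kernel of \<open>m\<close> is zero and componentwise, so every
  \<open>cmp m i\<close> is monic, hence a kernel in \<open>C\<close>. To obtain one natural arrow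
  with kernel \<open>m\<close>, a cokernel \<open>c\<close> of \<open>m\<close> is taken
  beforehand.\<close>

lemma mono_is_kernel_E:
  assumes m: "is_mono E m"
  shows "\<exists>f. is_kernel E m f"
proof -
  have m_Ar: "m \<in> Ar E" using m by (simp add: is_mono_def)
  obtain k where k: "is_kernel E k m" using ex_kernel_E[OF m_Ar] by blast
  obtain c where c: "is_cokernel E c m" using ex_cokernel_E[OF m_Ar] by blast
  have k_Zero: "k = Zero E (src k) (src m)"
    using E.is_mono_kernel_Zero[OF m k] by (simp add: functor_category_simps)
  have "is_kernel C (cmp m i) (cmp c i)" if i: "i \<in> Ob I" for i
  proof -
    have ker: "is_kernel C (cmp k i) (cmp m i)" and coker: "is_cokernel C (cmp c i) (cmp m i)"
      using k c i unfolding is_kernel_E_iff is_cokernel_E_iff by blast+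
    note k_in = cmp_in[OF HomI i, unfolded functor_category_simps]
    have "cmp k i = Zero C (omap (src k) i) (omap (src m) i)"
      using arg_cong[OF k_Zero, of "\<lambda>\<phi>. cmp \<phi> i"] cmp_Zero[OF i] by simp
    moreover have "Dom C (cmp k i) = omap (src k) i" "Dom C (cmp m i) = omap (src m) i"
      using k m_Ar HomD(2)[OF k_in] unfolding is_kernel_E_iff by blast+
    ultimately have "is_mono C (cmp m i)" using C.kernel_Zero_is_mono[OF ker] by simp
    \<comment> \<open>This \<open>h\<close> depends on \<open>i\<close> with no compatibility along
      \<open>I\<close>; \<open>kernel_of_cokernel\<close> exchanges it for the component of
      \<open>c\<close>.\<close>
    then obtain h where "is_kernel C (cmp m i) h" using C.mono_is_kernel by blast
    then show ?thesis using coker by (rule C.kernel_of_cokernel)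
  qed
  moreover have "c \<in> Ar E" "tgt m = src c" using c unfolding is_cokernel_E_iff by blast+
  ultimately have "is_kernel E m c" using m_Ar unfolding is_kernel_E_iff by blast
  then show ?thesis ..
qed

lemma epi_is_cokernel_E:
  assumes "is_epi E e"
  shows "\<exists>f. is_cokernel E e f"
proof -
  interpret op: functor_categories "op_cat I" "op_addcat C" by (rule functor_categories_op)
  obtain f where "is_kernel op.E (op_ntr e) f" using op.mono_is_kernel_E[OF is_epi_op_ntr[OF assms]] by blast
  then have "is_cokernel E e (op_ntr f)" unfolding is_cokernel_op_ntr op_ntr_simps .
  then show ?thesis ..
qed

section \<open>Biproducts, zero objects and exactness in functor categories\<close>

lemma ex_biproduct_E:
  assumes A: "A \<in> Ob E" and B: "B \<in> Ob E"
  shows "\<exists>P p q i j. is_biproduct E A B P p q i j"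
proof -
  have "\<forall>x\<in>Ob I. \<exists>P p q i j. is_biproduct C (omap A x) (omap B x) P p q i j"
    using C.ex_biproduct omap_in[OF A] omap_in[OF B] by simp
  then obtain P p q i j where
    bi: "\<And>x. x \<in> Ob I \<Longrightarrow> is_biproduct C (omap A x) (omap B x) (P x) (p x) (q x) (i x) (j x)" by metis
  note b = C.is_biproduct_in[OF bi] and Au = amap_in[OF A] and Bu = amap_in[OF B]
  have pj: "p x \<cdot>\<^bsub>C\<^esub> j x = Zero C (omap B x) (omap A x)"
    and qi: "q x \<cdot>\<^bsub>C\<^esub> i x = Zero C (omap A x) (omap B x)" if "x \<in> Ob I" for x
    using C.is_biproduct_proj_inj[OF bi[OF that]]
      C.is_biproduct_proj_inj[OF C.is_biproduct_swap[OF bi[OF that]]] .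
  \<comment> \<open>The structure maps of \<open>Q\<close> are pinned down by their projections, so
    naturality of the projections is built in and only that of the injections remains to be
    proved.\<close>
  have "\<exists>Q\<in>Ob E. (\<forall>x\<in>Ob I. omap Q x = P x) \<and> (\<forall>x y. \<forall>u\<in>Hom I x y.
      p y \<cdot>\<^bsub>C\<^esub> amap Q u = amap A u \<cdot>\<^bsub>C\<^esub> p x \<and> q y \<cdot>\<^bsub>C\<^esub> amap Q u = amap B u \<cdot>\<^bsub>C\<^esub> q x)"
  proof (rule ex_functr_of_ex1[OF I.category_axioms C.category_axioms, where ob = P and
        R = "\<lambda>x y u m. p y \<cdot>\<^bsub>C\<^esub> m = amap A u \<cdot>\<^bsub>C\<^esub> p x \<and> q y \<cdot>\<^bsub>C\<^esub> m = amap B u \<cdot>\<^bsub>C\<^esub> q x"])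
    fix x assume x: "x \<in> Ob I"
    show "P x \<in> Ob C" using b(1)[OF x] .
    show "p x \<cdot>\<^bsub>C\<^esub> Ident C (P x) = amap A (Ident I x) \<cdot>\<^bsub>C\<^esub> p x \<and>
        q x \<cdot>\<^bsub>C\<^esub> Ident C (P x) = amap B (Ident I x) \<cdot>\<^bsub>C\<^esub> q x"
      using C.Comp_Ident[OF b(2)[OF x]] C.Ident_Comp[OF b(2)[OF x]] amap_Ident[OF A x]
        C.Comp_Ident[OF b(3)[OF x]] C.Ident_Comp[OF b(3)[OF x]] amap_Ident[OF B x] by simp
  next
    fix u x y assume u: "u \<in> Hom I x y" and x: "x \<in> Ob I" and y: "y \<in> Ob I"
    show "\<exists>!m. m \<in> Hom C (P x) (P y) \<and> p y \<cdot>\<^bsub>C\<^esub> m = amap A u \<cdot>\<^bsub>C\<^esub> p x \<and> q y \<cdot>\<^bsub>C\<^esub> m = amap B u \<cdot>\<^bsub>C\<^esub> q x"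
      by (rule C.is_biproduct_ex1[OF bi[OF y] C.Comp_in[OF b(2)[OF x] Au[OF u]] C.Comp_in[OF b(3)[OF x] Bu[OF u]]])
  next
    fix u v x y z m n assume u: "u \<in> Hom I x y" and v: "v \<in> Hom I y z"
      and x: "x \<in> Ob I" and y: "y \<in> Ob I" and z: "z \<in> Ob I"
      and m: "m \<in> Hom C (P x) (P y)" and n: "n \<in> Hom C (P y) (P z)"
      and eqm: "p y \<cdot>\<^bsub>C\<^esub> m = amap A u \<cdot>\<^bsub>C\<^esub> p x \<and> q y \<cdot>\<^bsub>C\<^esub> m = amap B u \<cdot>\<^bsub>C\<^esub> q x"
      and eqn: "p z \<cdot>\<^bsub>C\<^esub> n = amap A v \<cdot>\<^bsub>C\<^esub> p y \<and> q z \<cdot>\<^bsub>C\<^esub> n = amap B v \<cdot>\<^bsub>C\<^esub> q y"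
    have "p z \<cdot>\<^bsub>C\<^esub> (n \<cdot>\<^bsub>C\<^esub> m) = amap A v \<cdot>\<^bsub>C\<^esub> (p y \<cdot>\<^bsub>C\<^esub> m)"
      using C.Comp_assoc[OF m n b(2)[OF z]] C.Comp_assoc[OF m b(2)[OF y] Au[OF v]] eqn by simp
    also have "\<dots> = amap A (v \<cdot>\<^bsub>I\<^esub> u) \<cdot>\<^bsub>C\<^esub> p x"
      using C.Comp_assoc[OF b(2)[OF x] Au[OF u] Au[OF v]] amap_Comp[OF A u v] eqm by simp
    finally have p: "p z \<cdot>\<^bsub>C\<^esub> (n \<cdot>\<^bsub>C\<^esub> m) = amap A (v \<cdot>\<^bsub>I\<^esub> u) \<cdot>\<^bsub>C\<^esub> p x" .
    have "q z \<cdot>\<^bsub>C\<^esub> (n \<cdot>\<^bsub>C\<^esub> m) = amap B v \<cdot>\<^bsub>C\<^esub> (q y \<cdot>\<^bsub>C\<^esub> m)"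
      using C.Comp_assoc[OF m n b(3)[OF z]] C.Comp_assoc[OF m b(3)[OF y] Bu[OF v]] eqn by simp
    also have "\<dots> = amap B (v \<cdot>\<^bsub>I\<^esub> u) \<cdot>\<^bsub>C\<^esub> q x"
      using C.Comp_assoc[OF b(3)[OF x] Bu[OF u] Bu[OF v]] amap_Comp[OF B u v] eqm by simp
    finally show "p z \<cdot>\<^bsub>C\<^esub> (n \<cdot>\<^bsub>C\<^esub> m) = amap A (v \<cdot>\<^bsub>I\<^esub> u) \<cdot>\<^bsub>C\<^esub> p x \<and>
        q z \<cdot>\<^bsub>C\<^esub> (n \<cdot>\<^bsub>C\<^esub> m) = amap B (v \<cdot>\<^bsub>I\<^esub> u) \<cdot>\<^bsub>C\<^esub> q x"
      using p by simp
  qed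
  then obtain Q where Q: "Q \<in> Ob E" "\<And>x. x \<in> Ob I \<Longrightarrow> omap Q x = P x"
    and Qp: "\<And>u x y. u \<in> Hom I x y \<Longrightarrow> p y \<cdot>\<^bsub>C\<^esub> amap Q u = amap A u \<cdot>\<^bsub>C\<^esub> p x"
    and Qq: "\<And>u x y. u \<in> Hom I x y \<Longrightarrow> q y \<cdot>\<^bsub>C\<^esub> amap Q u = amap B u \<cdot>\<^bsub>C\<^esub> q x" by metis
  let ?p = "\<lparr>src = Q, tgt = A, cmp = restrict p (Ob I)\<rparr>"
    and ?q = "\<lparr>src = Q, tgt = B, cmp = restrict q (Ob I)\<rparr>"
    and ?i = "\<lparr>src = A, tgt = Q, cmp = restrict i (Ob I)\<rparr>"
    and ?j = "\<lparr>src = B, tgt = Q, cmp = restrict j (Ob I)\<rparr>"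
  have p_in: "?p \<in> Hom E Q A"
    by (rule ntr_in_HomI[OF Q(1) A _ Qp I.category_axioms]) (simp add: Q(2) b(2))
  have q_in: "?q \<in> Hom E Q B"
    by (rule ntr_in_HomI[OF Q(1) B _ Qq I.category_axioms]) (simp add: Q(2) b(3))
  have Qu: "amap Q u \<in> Hom C (P x) (P y)" if "u \<in> Hom I x y" "x \<in> Ob I" "y \<in> Ob I" for u x y
    using amap_in[OF Q(1) that(1)] Q(2) that by simp
  have i_in: "?i \<in> Hom E A Q"
  proof (rule ntr_in_HomI[OF A Q(1) _ _ I.category_axioms])
    fix u x y assume u: "u \<in> Hom I x y" and x: "x \<in> Ob I" and y: "y \<in> Ob I"
    note Qu = Qu[OF u x y]
    \<comment> \<open>An arrow into \<open>P y\<close> is determined by its two projections. After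
      \<open>p y\<close> both sides reduce to \<open>amap A u\<close>; after \<open>q y\<close> both
      vanish by the mixed relation \<open>qi\<close>.\<close>
    show "i y \<cdot>\<^bsub>C\<^esub> amap A u = amap Q u \<cdot>\<^bsub>C\<^esub> i x"
    proof (rule C.is_biproduct_cancel[OF bi[OF y] C.Comp_in[OF Au[OF u] b(4)[OF y]] C.Comp_in[OF b(4)[OF x] Qu]])
      show "p y \<cdot>\<^bsub>C\<^esub> (i y \<cdot>\<^bsub>C\<^esub> amap A u) = p y \<cdot>\<^bsub>C\<^esub> (amap Q u \<cdot>\<^bsub>C\<^esub> i x)"
        using C.Comp_assoc[OF Au[OF u] b(4)[OF y] b(2)[OF y]] C.Comp_assoc[OF b(4)[OF x] Qu b(2)[OF y]]
          C.Comp_assoc[OF b(4)[OF x] b(2)[OF x] Au[OF u]] Qp[OF u] b(6)[OF x] b(6)[OF y]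
          C.Ident_Comp[OF Au[OF u]] C.Comp_Ident[OF Au[OF u]] by simp
      show "q y \<cdot>\<^bsub>C\<^esub> (i y \<cdot>\<^bsub>C\<^esub> amap A u) = q y \<cdot>\<^bsub>C\<^esub> (amap Q u \<cdot>\<^bsub>C\<^esub> i x)"
        using C.Comp_assoc[OF Au[OF u] b(4)[OF y] b(3)[OF y]] C.Comp_assoc[OF b(4)[OF x] Qu b(3)[OF y]]
          C.Comp_assoc[OF b(4)[OF x] b(3)[OF x] Bu[OF u]] Qq[OF u] qi[OF x] qi[OF y]
          C.Zero_Comp[OF Au[OF u] omap_in[OF B y]] C.Comp_Zero[OF Bu[OF u] omap_in[OF A x]] by simp
    qed
  qed (simp add: Q(2) b(4))
  have j_in: "?j \<in> Hom E B Q"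
  proof (rule ntr_in_HomI[OF B Q(1) _ _ I.category_axioms])
    fix u x y assume u: "u \<in> Hom I x y" and x: "x \<in> Ob I" and y: "y \<in> Ob I"
    note Qu = Qu[OF u x y]
    show "j y \<cdot>\<^bsub>C\<^esub> amap B u = amap Q u \<cdot>\<^bsub>C\<^esub> j x"
    proof (rule C.is_biproduct_cancel[OF bi[OF y] C.Comp_in[OF Bu[OF u] b(5)[OF y]] C.Comp_in[OF b(5)[OF x] Qu]])
      show "q y \<cdot>\<^bsub>C\<^esub> (j y \<cdot>\<^bsub>C\<^esub> amap B u) = q y \<cdot>\<^bsub>C\<^esub> (amap Q u \<cdot>\<^bsub>C\<^esub> j x)"
        using C.Comp_assoc[OF Bu[OF u] b(5)[OF y] b(3)[OF y]] C.Comp_assoc[OF b(5)[OF x] Qu b(3)[OF y]]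
          C.Comp_assoc[OF b(5)[OF x] b(3)[OF x] Bu[OF u]] Qq[OF u] b(7)[OF x] b(7)[OF y]
          C.Ident_Comp[OF Bu[OF u]] C.Comp_Ident[OF Bu[OF u]] by simp
      show "p y \<cdot>\<^bsub>C\<^esub> (j y \<cdot>\<^bsub>C\<^esub> amap B u) = p y \<cdot>\<^bsub>C\<^esub> (amap Q u \<cdot>\<^bsub>C\<^esub> j x)"
        using C.Comp_assoc[OF Bu[OF u] b(5)[OF y] b(2)[OF y]] C.Comp_assoc[OF b(5)[OF x] Qu b(2)[OF y]]
          C.Comp_assoc[OF b(5)[OF x] b(2)[OF x] Au[OF u]] Qp[OF u] pj[OF x] pj[OF y]
          C.Zero_Comp[OF Bu[OF u] omap_in[OF A y]] C.Comp_Zero[OF Au[OF u] omap_in[OF B x]] by simp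
    qed
  qed (simp add: Q(2) b(5))
  have "?p \<cdot>\<^bsub>E\<^esub> ?i = Ident E A"
    by (rule ntr_eqI[OF E.Comp_in[OF i_in p_in] E.Ident_in[OF A]]) (simp add: cmp_Comp cmp_Ident b(6))
  moreover have "?q \<cdot>\<^bsub>E\<^esub> ?j = Ident E B"
    by (rule ntr_eqI[OF E.Comp_in[OF j_in q_in] E.Ident_in[OF B]]) (simp add: cmp_Comp cmp_Ident b(7))
  moreover have "Add E (?i \<cdot>\<^bsub>E\<^esub> ?p) (?j \<cdot>\<^bsub>E\<^esub> ?q) = Ident E Q"
    by (rule ntr_eqI[OF E.Add_in[OF E.Comp_in[OF p_in i_in] E.Comp_in[OF q_in j_in]] E.Ident_in[OF Q(1)]])
      (simp add: cmp_Comp cmp_Ident cmp_Add b(8) Q(2))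
  ultimately have "is_biproduct E A B Q ?p ?q ?i ?j"
    using Q(1) p_in q_in i_in j_in by (simp add: is_biproduct_def)
  then show ?thesis by blast
qed

text \<open>By \<open>zero_object_iff\<close> the condition equates two natural transformations, and
  their components are the identities and zero arrows of \<open>C\<close>.\<close>

lemma zero_object_E_iff:
  "zero_object E A \<longleftrightarrow> A \<in> Ob E \<and> (\<forall>i\<in>Ob I. zero_object C (omap A i))"
proof
  assume "zero_object E A"
  then have A: "A \<in> Ob E" "Ident E A = Zero E A A" unfolding E.zero_object_iff by simp_all
  have "Ident C (omap A i) = Zero C (omap A i) (omap A i)" if "i \<in> Ob I" for i
    using arg_cong[OF A(2), of "\<lambda>\<phi>. cmp \<phi> i"] cmp_Ident[OF that] cmp_Zero[OF that] by simp
  then show "A \<in> Ob E \<and> (\<forall>i\<in>Ob I. zero_object C (omap A i))"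
    using A(1) omap_in[OF A(1)] by (simp add: C.zero_object_iff)
next
  assume A: "A \<in> Ob E \<and> (\<forall>i\<in>Ob I. zero_object C (omap A i))"
  have "Ident E A = Zero E A A"
    using A by (intro ntr_eqI[OF E.Ident_in E.Zero_in]) (simp_all add: cmp_Ident cmp_Zero C.zero_object_iff)
  then show "zero_object E A" using A by (simp add: E.zero_object_iff)
qed

lemma ex_zero_object_E: "\<exists>Z. zero_object E Z"
proof -
  obtain Z where Z: "zero_object C Z" using C.ex_zero_object by blast
  then have Z_Ob: "Z \<in> Ob C" by (simp add: C.zero_object_iff)
  \<comment> \<open>The constant functor at \<open>Z\<close>.\<close>
  have "\<lparr>omap = restrict (\<lambda>i. Z) (Ob I), amap = restrict (\<lambda>u. Ident C Z) (Ar I)\<rparr> \<in> Ob E"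
    by (rule functr_in_ObI) (simp_all add: Z_Ob C.Ident_in C.Ident_Comp[OF C.Ident_in] I.category_axioms)
  then have "zero_object E \<lparr>omap = restrict (\<lambda>i. Z) (Ob I), amap = restrict (\<lambda>u. Ident C Z) (Ar I)\<rparr>"
    unfolding zero_object_E_iff using Z by simp
  then show ?thesis ..
qed

sublocale E: abelian_category "functor_category I C"
  by (unfold_locales; fact ex_zero_object_E ex_biproduct_E ex_kernel_E ex_cokernel_E
      mono_is_kernel_E epi_is_cokernel_E)

text \<open>From right to left, pointwise exactness offers a different common representative at each
  \<open>i\<close>. Instead \<open>c\<close> and \<open>k\<close> are fixed in the functor category;
  their components are cokernels and kernels, and \<open>exact_kernel_of_cokernel\<close> shows that
  each \<open>cmp k i\<close> is a kernel of \<open>cmp g i\<close>.\<close>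

lemma exact_E_iff:
  "exact E f g \<longleftrightarrow> f \<in> Ar E \<and> g \<in> Ar E \<and> tgt f = src g \<and> (\<forall>i\<in>Ob I. exact C (cmp f i) (cmp g i))"
proof (intro iffI conjI ballI)
  assume ex: "exact E f g"
  then show fg: "f \<in> Ar E" "g \<in> Ar E" "tgt f = src g"
    by (simp_all add: exact_def functor_category_simps)
  obtain k c where kc: "is_cokernel E c f" "is_kernel E k c" "is_kernel E k g"
    using ex unfolding exact_def is_image_def by metis
  fix i assume i: "i \<in> Ob I"
  have "is_cokernel C (cmp c i) (cmp f i)" "is_kernel C (cmp k i) (cmp c i)" "is_kernel C (cmp k i) (cmp g i)"
    using kc i unfolding is_kernel_E_iff is_cokernel_E_iff by blast+
  then show "exact C (cmp f i) (cmp g i)"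
    using HomD[OF cmp_in[OF HomI[OF fg(1)] i]] HomD[OF cmp_in[OF HomI[OF fg(2)] i]] fg(3)
    unfolding exact_def is_image_def functor_category_simps by metis
next
  assume a: "f \<in> Ar E \<and> g \<in> Ar E \<and> tgt f = src g \<and> (\<forall>i\<in>Ob I. exact C (cmp f i) (cmp g i))"
  then obtain c where c: "is_cokernel E c f" using ex_cokernel_E by blast
  then have c_Ar: "c \<in> Ar E" "src c = tgt f" by (simp_all add: is_cokernel_E_iff)
  then obtain k where k: "is_kernel E k c" using ex_kernel_E by blast
  have "is_kernel C (cmp k i) (cmp g i)" if "i \<in> Ob I" for i
    using a c k that C.exact_kernel_of_cokernel unfolding is_kernel_E_iff is_cokernel_E_iff by metis
  then have "is_kernel E k g" using k a c_Ar unfolding is_kernel_E_iff by simp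
  then show "exact E f g"
    using a c k unfolding exact_def is_image_def functor_category_simps by metis
qed

text \<open>The connecting map of an exponent is built from \<open>dlt F\<close> at the components,
  and the axioms for \<open>F\<close> speak of short exact sequences only. The zero object at the
  two ends is componentwise zero, so all three exactness conditions restrict to
  \<open>i\<close>.\<close>

lemma short_exact_E_D:
  assumes "short_exact E f g"
  shows "f \<in> Ar E" "g \<in> Ar E" "tgt f = src g"
    and "i \<in> Ob I \<Longrightarrow> short_exact C (cmp f i) (cmp g i)"
proof -
  obtain Z where Z: "zero_object E Z" and ex: "exact E (Zero E Z (Dom E f)) f" "exact E f g"
    "exact E g (Zero E (Cod E g) Z)"
    using assms unfolding short_exact_def by blast
  show fg: "f \<in> Ar E" "g \<in> Ar E" "tgt f = src g" using ex(2) unfolding exact_E_iff by simp_all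
  assume i: "i \<in> Ob I"
  have "zero_object C (omap Z i)" using Z i unfolding zero_object_E_iff by simp
  moreover have "exact C (Zero C (omap Z i) (Dom C (cmp f i))) (cmp f i)" "exact C (cmp f i) (cmp g i)"
    "exact C (cmp g i) (Zero C (Cod C (cmp g i)) (omap Z i))"
    using ex i HomD[OF cmp_in[OF HomI[OF fg(1)] i]] HomD[OF cmp_in[OF HomI[OF fg(2)] i]]
    by (simp_all add: exact_E_iff cmp_Zero)
  ultimately show "short_exact C (cmp f i) (cmp g i)" unfolding short_exact_def by blast
qed

end


section \<open>Exponents\<close>

lemma is_functorD:
  assumes "is_functor C D F"
  shows "A \<in> Ob C \<Longrightarrow> omap F A \<in> Ob D"
    and "f \<in> Hom C A B \<Longrightarrow> amap F f \<in> Hom D (omap F A) (omap F B)"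
    and "A \<in> Ob C \<Longrightarrow> amap F (Ident C A) = Ident D (omap F A)"
    and "f \<in> Hom C A B \<Longrightarrow> g \<in> Hom C B X \<Longrightarrow> amap F (g \<cdot>\<^bsub>C\<^esub> f) = amap F g \<cdot>\<^bsub>D\<^esub> amap F f"
  using assms by (auto simp: is_functor_def Hom_def)

lemma exp_obj_simps [simp]:
  "i \<in> Ob I \<Longrightarrow> omap (exp_obj I F A) i = omap F (omap A i)"
  "u \<in> Ar I \<Longrightarrow> amap (exp_obj I F A) u = amap F (amap A u)"
  by (simp_all add: exp_obj_def)

lemma exp_functor_simps:
  "omap (exp_functor I F) = exp_obj I F"
  "amap (exp_functor I F) \<phi> = \<lparr>src = exp_obj I F (src \<phi>), tgt = exp_obj I F (tgt \<phi>),
    cmp = (\<lambda>i\<in>Ob I. amap F (cmp \<phi> i))\<rparr>"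
  by (simp_all add: exp_functor_def)

lemma exp_delta_simps:
  "fn (exp_delta I F) n = exp_functor I (fn F n)"
  "dlt (exp_delta I F) n f g =
    \<lparr>src = exp_obj I (fn F n) (tgt g), tgt = exp_obj I (fn F (n - 1)) (src f),
      cmp = (\<lambda>i\<in>Ob I. dlt F n (cmp f i) (cmp g i))\<rparr>"
  by (simp_all add: exp_delta_def)

locale exponents = C: functor_categories I C + D: functor_categories I D
  for I :: "('i, 'j) cat" and C :: "('o, 'm) addcat" and D :: "('p, 'n) addcat"
begin

lemma exp_obj_in:
  assumes F: "is_functor C D F" and A: "A \<in> Ob C.E"
  shows "exp_obj I F A \<in> Ob D.E"
  unfolding exp_obj_def
proof (rule functr_in_ObI[OF _ _ _ _ C.I.category_axioms])
  note F = is_functorD[OF F] and Au = amap_in[OF A]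
  show "omap F (omap A i) \<in> Ob D" if "i \<in> Ob I" for i using F(1)[OF omap_in[OF A that]] .
  show "amap F (amap A u) \<in> Hom D (omap F (omap A i)) (omap F (omap A j))" if "u \<in> Hom I i j" for u i j
    using F(2)[OF Au[OF that]] .
  show "amap F (amap A (Ident I i)) = Ident D (omap F (omap A i))" if "i \<in> Ob I" for i
    using amap_Ident[OF A that] F(3)[OF omap_in[OF A that]] by simp
  show "amap F (amap A (v \<cdot>\<^bsub>I\<^esub> u)) = amap F (amap A v) \<cdot>\<^bsub>D\<^esub> amap F (amap A u)"
    if "u \<in> Hom I i j" "v \<in> Hom I j k" for u v i j k
    using amap_Comp[OF A that] F(4)[OF Au[OF that(1)] Au[OF that(2)]] by simp
qed

lemma exp_functor_in:
  assumes F: "is_functor C D F" and \<phi>: "\<phi> \<in> Hom C.E A B"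
  shows "amap (exp_functor I F) \<phi> \<in> Hom D.E (exp_obj I F A) (exp_obj I F B)"
proof -
  note O = C.Hom_E_Ob[OF \<phi>]
  have "src \<phi> = A" "tgt \<phi> = B" using \<phi> by (simp_all add: functor_category_Hom_iff)
  then show ?thesis
    unfolding exp_functor_simps
  proof (simp only:, intro ntr_in_HomI[OF exp_obj_in[OF F O(1)] exp_obj_in[OF F O(2)] _ _ C.I.category_axioms])
    show "amap F (cmp \<phi> i) \<in> Hom D (omap (exp_obj I F A) i) (omap (exp_obj I F B) i)" if "i \<in> Ob I" for i
      using is_functorD(2)[OF F cmp_in[OF \<phi> that]] that by simp
    fix u i j assume u: "u \<in> Hom I i j" and i: "i \<in> Ob I" and j: "j \<in> Ob I"
    show "amap F (cmp \<phi> j) \<cdot>\<^bsub>D\<^esub> amap (exp_obj I F A) u = amap (exp_obj I F B) u \<cdot>\<^bsub>D\<^esub> amap F (cmp \<phi> i)"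
      using is_functorD(4)[OF F amap_in[OF O(1) u] cmp_in[OF \<phi> j]]
        is_functorD(4)[OF F cmp_in[OF \<phi> i] amap_in[OF O(2) u]] cmp_natural[OF \<phi> u] HomD(1)[OF u] by simp
  qed
qed

lemma cmp_exp_functor: "i \<in> Ob I \<Longrightarrow> cmp (amap (exp_functor I F) \<phi>) i = amap F (cmp \<phi> i)"
  by (simp add: exp_functor_simps)

lemma is_functor_exp:
  assumes F: "is_functor C D F"
  shows "is_functor C.E D.E (exp_functor I F)"
  unfolding is_functor_def
proof (intro conjI ballI impI)
  fix A assume A: "A \<in> Ob C.E"
  note Id = C.E.Ident_in[OF A]
  show A': "omap (exp_functor I F) A \<in> Ob D.E" using exp_obj_in[OF F A] by (simp add: exp_functor_simps)
  show "amap (exp_functor I F) (Ident C.E A) = Ident D.E (omap (exp_functor I F) A)"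
    unfolding exp_functor_simps(1)
    by (rule ntr_eqI[OF exp_functor_in[OF F Id] D.E.Ident_in[OF exp_obj_in[OF F A]]])
      (simp add: cmp_exp_functor C.cmp_Ident D.cmp_Ident is_functorD(3)[OF F omap_in[OF A]])
next
  fix f assume f: "f \<in> Ar C.E"
  show "amap (exp_functor I F) f \<in>
      Hom D.E (omap (exp_functor I F) (Dom C.E f)) (omap (exp_functor I F) (Cod C.E f))"
    using exp_functor_in[OF F HomI[OF f]] by (simp only: exp_functor_simps(1))
  fix g assume g: "g \<in> Ar C.E" and eq: "Cod C.E f = Dom C.E g"
  have f: "f \<in> Hom C.E (Dom C.E f) (Dom C.E g)" using HomI[OF f] eq by simp
  note g = HomI[OF g]
  show "amap (exp_functor I F) (g \<cdot>\<^bsub>C.E\<^esub> f) = amap (exp_functor I F) g \<cdot>\<^bsub>D.E\<^esub> amap (exp_functor I F) f"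
    by (rule ntr_eqI[OF exp_functor_in[OF F C.E.Comp_in[OF f g]]
          D.E.Comp_in[OF exp_functor_in[OF F f] exp_functor_in[OF F g]]])
      (simp add: cmp_exp_functor C.cmp_Comp D.cmp_Comp is_functorD(4)[OF F cmp_in[OF f] cmp_in[OF g]])
qed

lemma additive_functor_exp:
  assumes "additive_functor C D F"
  shows "additive_functor C.E D.E (exp_functor I F)"
  unfolding additive_functor_def
proof (intro conjI ballI impI)
  have F: "is_functor C D F" using assms by (simp add: additive_functor_def)
  have F_Add: "amap F (Add C f g) = Add D (amap F f) (amap F g)" if "f \<in> Hom C A B" "g \<in> Hom C A B" for f g A B
    using assms HomD[OF that(1)] HomD[OF that(2)] by (simp add: additive_functor_def)
  show "is_functor C.E D.E (exp_functor I F)" by (rule is_functor_exp[OF F])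
  fix f g assume "f \<in> Ar C.E" "g \<in> Ar C.E" "Dom C.E f = Dom C.E g \<and> Cod C.E f = Cod C.E g"
  then have f: "f \<in> Hom C.E (Dom C.E f) (Cod C.E f)" and g: "g \<in> Hom C.E (Dom C.E f) (Cod C.E f)"
    by (auto simp: Hom_def)
  show "amap (exp_functor I F) (Add C.E f g) =
      Add D.E (amap (exp_functor I F) f) (amap (exp_functor I F) g)"
    by (rule ntr_eqI[OF exp_functor_in[OF F C.E.Add_in[OF f g]]
          D.E.Add_in[OF exp_functor_in[OF F f] exp_functor_in[OF F g]]])
      (simp add: cmp_exp_functor C.cmp_Add D.cmp_Add F_Add[OF cmp_in[OF f] cmp_in[OF g]])
qed

text \<open>For arrows known to be composable only the componentwise condition is left; in this form
  the long exact sequence is inherited from \<open>D\<close>.\<close>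

lemma exact_exp_iff:
  assumes "f \<in> Hom D.E A B" "g \<in> Hom D.E B X"
  shows "exact D.E f g \<longleftrightarrow> (\<forall>i\<in>Ob I. exact D (cmp f i) (cmp g i))"
  using assms by (auto simp: D.exact_E_iff Hom_def functor_category_simps)

section \<open>Exponents of delta-functors and of their morphisms\<close>

lemma homological_delta_functor_exp:
  assumes "homological_delta_functor C D F"
  shows "homological_delta_functor C.E D.E (exp_delta I F)"
proof -
  interpret F: homological_delta_functor C D F by (rule assms)
  have F: "is_functor C D (fn F n)" for n using F.additive by (simp add: additive_functor_def)
  have Homs: "f \<in> Hom C.E (Dom C.E f) (Cod C.E f)" "g \<in> Hom C.E (Cod C.E f) (Cod C.E g)"
    if "short_exact C.E f g" for f g
    using C.short_exact_E_D(1-3)[OF that] by (simp_all add: Hom_def functor_category_simps)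
  have at: "short_exact C (cmp f i) (cmp g i)"
    "cmp f i \<in> Hom C (omap (Dom C.E f) i) (omap (Cod C.E f) i)"
    "cmp g i \<in> Hom C (omap (Cod C.E f) i) (omap (Cod C.E g) i)"
    if "short_exact C.E f g" "i \<in> Ob I" for f g i
    using C.short_exact_E_D(4)[OF that] cmp_in[OF Homs(1)[OF that(1)] that(2)]
      cmp_in[OF Homs(2)[OF that(1)] that(2)] .
  have dlt_at: "dlt F n (cmp f i) (cmp g i) \<in>
      Hom D (omap (fn F n) (omap (Cod C.E g) i)) (omap (fn F (n - 1)) (omap (Dom C.E f) i))"
    if "short_exact C.E f g" "i \<in> Ob I" for f g i n
    using F.dlt_in[OF at(1)[OF that], of n] HomD[OF at(2)[OF that]] HomD[OF at(3)[OF that]] by simp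
  have cmp_dlt: "cmp (dlt (exp_delta I F) n f g) i = dlt F n (cmp f i) (cmp g i)" if "i \<in> Ob I" for n f g i
    using that by (simp add: exp_delta_simps)
  have dlt_in: "dlt (exp_delta I F) n f g \<in>
      Hom D.E (exp_obj I (fn F n) (Cod C.E g)) (exp_obj I (fn F (n - 1)) (Dom C.E f))"
    if se: "short_exact C.E f g" for n f g
    unfolding exp_delta_simps functor_category_simps(1,2)
  proof (rule ntr_in_HomI[OF _ _ _ _ C.I.category_axioms])
    note f = Homs(1)[OF se] and g = Homs(2)[OF se]
    show "exp_obj I (fn F n) (tgt g) \<in> Ob D.E" "exp_obj I (fn F (n - 1)) (src f) \<in> Ob D.E"
      using exp_obj_in[OF F C.Hom_E_Ob(2)[OF g]] exp_obj_in[OF F C.Hom_E_Ob(1)[OF f]]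
      by (simp_all add: functor_category_simps)
    show "dlt F n (cmp f i) (cmp g i) \<in>
        Hom D (omap (exp_obj I (fn F n) (tgt g)) i) (omap (exp_obj I (fn F (n - 1)) (src f)) i)"
      if "i \<in> Ob I" for i
      using dlt_at[OF se that] that by (simp add: functor_category_simps)
    fix u i j assume u: "u \<in> Hom I i j" and i: "i \<in> Ob I" and j: "j \<in> Ob I"
    \<comment> \<open>The three vertical arrows are the structure maps at \<open>u\<close>. The
      middle one occurs only in the hypotheses of \<open>F.dlt_natural\<close>, so it has to be
      named.\<close>
    have "amap (fn F (n - 1)) (amap (Dom C.E f) u) \<cdot>\<^bsub>D\<^esub> dlt F n (cmp f i) (cmp g i) =
        dlt F n (cmp f j) (cmp g j) \<cdot>\<^bsub>D\<^esub> amap (fn F n) (amap (Cod C.E g) u)"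
      using amap_in[OF C.Hom_E_Ob(1)[OF f] u] amap_in[OF C.Hom_E_Ob(2)[OF f] u] amap_in[OF C.Hom_E_Ob(2)[OF g] u]
        HomD[OF at(2)[OF se i]] HomD[OF at(3)[OF se i]] HomD[OF at(2)[OF se j]] HomD[OF at(3)[OF se j]]
      by (intro F.dlt_natural[OF at(1)[OF se i] at(1)[OF se j], where b = "amap (Cod C.E f) u"])
        (simp_all add: cmp_natural[OF f u] cmp_natural[OF g u])
    then show "dlt F n (cmp f j) (cmp g j) \<cdot>\<^bsub>D\<^esub> amap (exp_obj I (fn F n) (tgt g)) u =
        amap (exp_obj I (fn F (n - 1)) (src f)) u \<cdot>\<^bsub>D\<^esub> dlt F n (cmp f i) (cmp g i)"
      using HomD(1)[OF u] by (simp add: functor_category_simps)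
  qed
  show ?thesis
  proof (intro homological_delta_functor.intro C.E.abelian_category_axioms D.E.abelian_category_axioms
      homological_delta_functor_axioms.intro, unfold exp_delta_simps(1))
    show "additive_functor C.E D.E (exp_functor I (fn F n))" for n
      by (rule additive_functor_exp[OF F.additive])
    show "zero_object D.E (omap (exp_functor I (fn F n)) A)" if "n < 0" "A \<in> Ob C.E" for n A
      using exp_obj_in[OF F that(2)] F.vanish[OF that(1) omap_in[OF that(2)]]
      by (simp add: D.zero_object_E_iff exp_functor_simps)
  next
    fix f g n assume se: "short_exact C.E f g"
    note f = exp_functor_in[OF F Homs(1)[OF se]] and g = exp_functor_in[OF F Homs(2)[OF se]]
    note \<delta> = dlt_in[OF se]
    \<comment> \<open>The index of the target is \<open>n + 1 - 1\<close>, which must be simplified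
      to \<open>n\<close> before the connecting map can be composed with the arrow induced by
      \<open>f\<close>.\<close>
    have \<delta>': "dlt (exp_delta I F) (n + 1) f g \<in>
        Hom D.E (exp_obj I (fn F (n + 1)) (Cod C.E g)) (exp_obj I (fn F n) (Dom C.E f))"
      using \<delta>[of "n + 1"] by simp
    show "dlt (exp_delta I F) n f g \<in>
        Hom D.E (omap (exp_functor I (fn F n)) (Cod C.E g)) (omap (exp_functor I (fn F (n - 1))) (Dom C.E f))"
      using \<delta> by (simp only: exp_functor_simps(1))
    show "exact D.E (dlt (exp_delta I F) (n + 1) f g) (amap (exp_functor I (fn F n)) f)"
      using exact_exp_iff[OF \<delta>' f] F.exact_left[OF at(1)[OF se]] by (simp add: cmp_dlt cmp_exp_functor)
    show "exact D.E (amap (exp_functor I (fn F n)) f) (amap (exp_functor I (fn F n)) g)"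
      using exact_exp_iff[OF f g] F.exact_mid[OF at(1)[OF se]] by (simp add: cmp_exp_functor)
    show "exact D.E (amap (exp_functor I (fn F n)) g) (dlt (exp_delta I F) n f g)"
      using exact_exp_iff[OF g \<delta>] F.exact_right[OF at(1)[OF se]] by (simp add: cmp_dlt cmp_exp_functor)
  next
    fix f g f' g' a b c n
    assume se: "short_exact C.E f g" and se': "short_exact C.E f' g'"
      and a: "a \<in> Hom C.E (Dom C.E f) (Dom C.E f')" and b: "b \<in> Hom C.E (Cod C.E f) (Cod C.E f')"
      and c: "c \<in> Hom C.E (Cod C.E g) (Cod C.E g')"
      and eq: "b \<cdot>\<^bsub>C.E\<^esub> f = f' \<cdot>\<^bsub>C.E\<^esub> a" "c \<cdot>\<^bsub>C.E\<^esub> g = g' \<cdot>\<^bsub>C.E\<^esub> b"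
    show "amap (exp_functor I (fn F (n - 1))) a \<cdot>\<^bsub>D.E\<^esub> dlt (exp_delta I F) n f g =
        dlt (exp_delta I F) n f' g' \<cdot>\<^bsub>D.E\<^esub> amap (exp_functor I (fn F n)) c"
    proof (rule ntr_eqI[OF D.E.Comp_in[OF dlt_in[OF se] exp_functor_in[OF F a]]
            D.E.Comp_in[OF exp_functor_in[OF F c] dlt_in[OF se']]])
      fix i assume i: "i \<in> Ob I"
      have "cmp b i \<cdot>\<^bsub>C\<^esub> cmp f i = cmp f' i \<cdot>\<^bsub>C\<^esub> cmp a i" "cmp c i \<cdot>\<^bsub>C\<^esub> cmp g i = cmp g' i \<cdot>\<^bsub>C\<^esub> cmp b i"
        using arg_cong[OF eq(1), of "\<lambda>\<phi>. cmp \<phi> i"] arg_cong[OF eq(2), of "\<lambda>\<phi>. cmp \<phi> i"]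
        by (simp_all add: C.cmp_Comp[OF i])
      then have "amap (fn F (n - 1)) (cmp a i) \<cdot>\<^bsub>D\<^esub> dlt F n (cmp f i) (cmp g i) =
          dlt F n (cmp f' i) (cmp g' i) \<cdot>\<^bsub>D\<^esub> amap (fn F n) (cmp c i)"
        using cmp_in[OF a i] cmp_in[OF b i] cmp_in[OF c i]
          HomD[OF at(2)[OF se i]] HomD[OF at(3)[OF se i]] HomD[OF at(2)[OF se' i]] HomD[OF at(3)[OF se' i]]
        by (intro F.dlt_natural[OF at(1)[OF se i] at(1)[OF se' i], where b = "cmp b i"]) simp_all
      then show "cmp (amap (exp_functor I (fn F (n - 1))) a \<cdot>\<^bsub>D.E\<^esub> dlt (exp_delta I F) n f g) i =
          cmp (dlt (exp_delta I F) n f' g' \<cdot>\<^bsub>D.E\<^esub> amap (exp_functor I (fn F n)) c) i"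
        by (simp add: D.cmp_Comp[OF i] cmp_dlt[OF i] cmp_exp_functor[OF i])
    qed
  qed
qed

text \<open>Naturality of \<open>\<eta> n\<close> in \<open>C\<close> serves twice: at the structure
  maps of \<open>A\<close> it makes each \<open>exp_morphism I F G \<eta> n A\<close> an arrow of
  the functor category, and at the components of an arrow \<open>f\<close> of that category it gives
  naturality in \<open>A\<close>.\<close>

lemma delta_functor_morphism_exp:
  assumes "delta_functor_morphism C D F G \<eta>"
  shows "delta_functor_morphism C.E D.E (exp_delta I F) (exp_delta I G) (exp_morphism I F G \<eta>)"
proof -
  interpret eta: delta_functor_morphism C D F G \<eta> by (rule assms)
  interpret FI: homological_delta_functor C.E D.E "exp_delta I F"
    by (rule homological_delta_functor_exp[OF eta.F.homological_delta_functor_axioms])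
  interpret GI: homological_delta_functor C.E D.E "exp_delta I G"
    by (rule homological_delta_functor_exp[OF eta.G.homological_delta_functor_axioms])
  have F: "is_functor C D (fn F n)" and G: "is_functor C D (fn G n)" for n
    using eta.F.additive eta.G.additive by (simp_all add: additive_functor_def)
  have \<eta>_in: "\<eta> n X \<in> Hom D (omap (fn F n) X) (omap (fn G n) X)" if "X \<in> Ob C" for n X
    using eta.nat_trans that unfolding is_nat_trans_def by blast
  have \<eta>_natural: "\<eta> n Y \<cdot>\<^bsub>D\<^esub> amap (fn F n) f = amap (fn G n) f \<cdot>\<^bsub>D\<^esub> \<eta> n X" if "f \<in> Hom C X Y" for n f X Y
    using eta.nat_trans[of n] HomD[OF that] unfolding is_nat_trans_def by auto
  have cmp_\<eta>: "cmp (exp_morphism I F G \<eta> n A) i = \<eta> n (omap A i)" if "i \<in> Ob I" for n A i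
    using that by (simp add: exp_morphism_def)
  have \<eta>I_in: "exp_morphism I F G \<eta> n A \<in> Hom D.E (exp_obj I (fn F n) A) (exp_obj I (fn G n) A)"
    if A: "A \<in> Ob C.E" for n A
    unfolding exp_morphism_def
  proof (rule ntr_in_HomI[OF exp_obj_in[OF F A] exp_obj_in[OF G A] _ _ C.I.category_axioms])
    show "\<eta> n (omap A i) \<in> Hom D (omap (exp_obj I (fn F n) A) i) (omap (exp_obj I (fn G n) A) i)"
      if "i \<in> Ob I" for i
      using \<eta>_in[OF omap_in[OF A that]] that by simp
    show "\<eta> n (omap A j) \<cdot>\<^bsub>D\<^esub> amap (exp_obj I (fn F n) A) u =
        amap (exp_obj I (fn G n) A) u \<cdot>\<^bsub>D\<^esub> \<eta> n (omap A i)" if "u \<in> Hom I i j" for u i j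
      using \<eta>_natural[OF amap_in[OF A that]] HomD(1)[OF that] by simp
  qed
  show ?thesis
  proof unfold_locales
    fix n
    show "is_nat_trans C.E D.E (fn (exp_delta I F) n) (fn (exp_delta I G) n) (exp_morphism I F G \<eta> n)"
      unfolding is_nat_trans_def exp_delta_simps(1)
    proof (intro conjI ballI)
      fix A assume "A \<in> Ob C.E"
      then show "exp_morphism I F G \<eta> n A \<in>
          Hom D.E (omap (exp_functor I (fn F n)) A) (omap (exp_functor I (fn G n)) A)"
        unfolding exp_functor_simps(1) by (rule \<eta>I_in)
    next
      fix f assume f: "f \<in> Ar C.E"
      note f = HomI[OF f]
      show "exp_morphism I F G \<eta> n (Cod C.E f) \<cdot>\<^bsub>D.E\<^esub> amap (exp_functor I (fn F n)) f =
          amap (exp_functor I (fn G n)) f \<cdot>\<^bsub>D.E\<^esub> exp_morphism I F G \<eta> n (Dom C.E f)"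
        by (rule ntr_eqI[OF D.E.Comp_in[OF exp_functor_in[OF F f] \<eta>I_in[OF C.Hom_E_Ob(2)[OF f]]]
              D.E.Comp_in[OF \<eta>I_in[OF C.Hom_E_Ob(1)[OF f]] exp_functor_in[OF G f]]])
          (simp add: D.cmp_Comp cmp_exp_functor cmp_\<eta> \<eta>_natural[OF cmp_in[OF f]])
    qed
    fix f g assume se: "short_exact C.E f g"
    have f: "f \<in> Hom C.E (Dom C.E f) (Cod C.E f)" and g: "g \<in> Hom C.E (Cod C.E f) (Cod C.E g)"
      using C.short_exact_E_D(1-3)[OF se] by (simp_all add: Hom_def functor_category_simps)
    show "exp_morphism I F G \<eta> (n - 1) (Dom C.E f) \<cdot>\<^bsub>D.E\<^esub> dlt (exp_delta I F) n f g =
        dlt (exp_delta I G) n f g \<cdot>\<^bsub>D.E\<^esub> exp_morphism I F G \<eta> n (Cod C.E g)"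
    proof (rule ntr_eqI[OF
          D.E.Comp_in[OF FI.dlt_in[OF se, unfolded exp_delta_simps(1) exp_functor_simps(1)] \<eta>I_in[OF C.Hom_E_Ob(1)[OF f]]]
          D.E.Comp_in[OF \<eta>I_in[OF C.Hom_E_Ob(2)[OF g]] GI.dlt_in[OF se, unfolded exp_delta_simps(1) exp_functor_simps(1)]]])
      fix i assume i: "i \<in> Ob I"
      show "cmp (exp_morphism I F G \<eta> (n - 1) (Dom C.E f) \<cdot>\<^bsub>D.E\<^esub> dlt (exp_delta I F) n f g) i =
          cmp (dlt (exp_delta I G) n f g \<cdot>\<^bsub>D.E\<^esub> exp_morphism I F G \<eta> n (Cod C.E g)) i"
        using eta.dlt_commute[OF C.short_exact_E_D(4)[OF se i], of n]
          HomD(2)[OF cmp_in[OF f i]] HomD(3)[OF cmp_in[OF g i]]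
        by (simp add: D.cmp_Comp[OF i] cmp_\<eta>[OF i] exp_delta_simps(2) i)
    qed
  qed
qed

end

theorem proposition2p1:
  fixes C :: "('o, 'm) addcat" and D :: "('p, 'n) addcat" and I :: "('i, 'j) cat"
    and F :: "('o, 'm, 'p, 'n) delta_data"
  assumes "abelian_category C" and "abelian_category D" and "category I"
    and "homological_delta_functor C D F"
  shows "homological_delta_functor (functor_category I C) (functor_category I D) (exp_delta I F) \<and>
    (\<forall>G \<eta>. homological_delta_functor C D G \<longrightarrow> delta_functor_morphism C D F G \<eta> \<longrightarrow>
      delta_functor_morphism (functor_category I C) (functor_category I D)
        (exp_delta I F) (exp_delta I G) (exp_morphism I F G \<eta>))"
proof -
  interpret exponents I C D
    using assms by (simp add: exponents_def functor_categories_def)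
  show ?thesis
    using homological_delta_functor_exp[OF assms(4)] delta_functor_morphism_exp by blast
qed

end
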